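(* Suppose $\rho_q=\mathrm{Rq}(q)$ satisfies $\lambda_1\le\rho_q<\lambda_1+\frac{\lambda_2-\lambda_1}{2+\chi_P}$, and let $\kappa_P=L_P/\mu_P$. Assume that (i) the step-size $\tau_P$ satisfies $0<\tau_P\le\kappa_P^{-1/2}$; (ii) the initial vector $x_0\in\mathcal{X}$ satisfies $$0\le \mathrm{Rq}(x_0)-\lambda_1\le\frac{1}{\max\{8\kappa_P,\,2\kappa_P(1+\tau_P\kappa_P)^2\}}\,(\rho_q-\lambda_1);$$ (iii) $z_0=x_0$. Then the sequence $\{x_k\}$ generated by the EPIC iteration (with preconditioner $T$, step-size $\tau_P$ and $\mu=\mu_P$) satisfies, for every $k\geq 1$, $$\mathrm{Rq}(x_k)\le\mathrm{Rq}(x_{k-1})\le\dots\le\mathrm{Rq}(x_0)$$ and $$\mathrm{Rq}(x_k)-\lambda_1\le 2(1-\tau_P)^k\bigl(\mathrm{Rq}(x_0)-\lambda_1\bigr).$$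
   Context: Let $A,M\in\mathbb{R}^{n\times n}$ be symmetric positive definite. The eigenvalues of the pencil $(A,M)$ are $0<\lambda_1<\lambda_2\le\dots\le\lambda_n$, with eigenvectors $u_1,\dots,u_n$: $Au_i=\lambda_iMu_i$, $u_i^{\mathsf T}Mu_j=0$ for $i\ne j$, $\|u_i\|_M=1$, where $\|x\|_M=(x^{\mathsf T}Mx)^{1/2}$. $\mathrm{Rq}(x)=\frac{x^{\mathsf T}Ax}{x^{\mathsf T}Mx}$. Let $q\in\mathbb{R}^n$ satisfy $\|q\|_M=1$, $q^{\mathsf T}Mu_1>0$, and write $\rho_q=\mathrm{Rq}(q)$. Let $Q\in\mathbb{R}^{n\times(n-1)}$ be such that $[q,Q]^{\mathsf T}M[q,Q]=I$. Define $\mathcal{X}=\{x\in\mathbb{R}^n: \|x\|_M=1,\ q^{\mathsf T}Mx>0,\ \mathrm{Rq}(x)\le\rho_q\}$. Let $T\in\mathbb{R}^{n\times n}$ be symmetric positive definite (the preconditioner), $P=Q^{\mathsf T}TQ$, $B=Q^{\mathsf T}AQ$, and let $\xi_{\min},\xi_{\max}$ be the smallest and largest eigenvalues of the pencil $(B,P)$. Define $$\chi_{P}=\frac{8\lambda_{2}}{\lambda_{1}}\frac{\xi_{\max}}{\xi_{\min}}\Bigl(\frac{\lambda_{2}+\lambda_{1}}{2(\lambda_{2}-\lambda_{1})}\Bigr)^{1/2},$$ $$\mu_{P}=2\xi_{\min}\Bigl(1-\frac{4(\rho_{q}-\lambda_{1})}{\lambda_{2}-\lambda_{1}}\Bigr)\Bigl(1-\frac{\lambda_{1}}{\lambda_{2}}-\frac{2+\chi_{P}}{\lambda_{2}}(\rho_{q}-\lambda_{1})\Bigr),$$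 $$L_{P}=2\xi_{\max}\Bigl(1-\frac{\lambda_{1}}{\lambda_{n}}+\frac{\chi_{P}}{\lambda_{2}}\frac{\xi_{\min}}{\xi_{\max}}(\rho_{q}-\lambda_{1})\Bigr).$$ EPIC iteration (step-size $\tau_P$, parameter $\mu$). Let $\widetilde q=T^{-1}Mq$ and $\Pi=I-\frac{\widetilde q q^{\mathsf T}M}{q^{\mathsf T}M\widetilde q}$. Starting from $x_0,z_0$, for $k=0,1,2,\dots$: $$\overline{x}_k=\frac{1}{\eta_1}\Bigl(\frac{x_k}{q^{\mathsf T}Mx_k}+\frac{\tau_P z_k}{q^{\mathsf T}Mz_k}\Bigr),$$ $$r_k=2\bigl(A\overline{x}_k-\mathrm{Rq}(\overline{x}_k)M\overline{x}_k\bigr),\qquad \widetilde r_k=\Pi T^{-1}r_k,$$ $$z_{k+1}=\frac{1}{\eta_2}\Bigl(\frac{(1-\tau_P)z_k}{q^{\mathsf T}Mz_k}+\frac{\tau_P\overline{x}_k}{q^{\mathsf T}M\overline{x}_k}-\frac{\tau_P(q^{\mathsf T}M\overline{x}_k)\,\widetilde r_k}{\mu}\Bigr),$$ $$x_{k+1}=\operatorname*{arg\,min}_{x\in\mathcal{X}\cap\mathrm{span}\{q,x_k,\overline{x}_k,\widetilde r_k\}}\mathrm{Rq}(x),$$ where $\eta_1,\eta_2>0$ (depending on $k$) are normalization factors making $\|\overline{x}_k\|_M=1$ and $\|z_{k+1}\|_M=1$. *)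

theory Defs
  imports "HOL-Analysis.Analysis"
begin

definition spd :: "real^'n^'n \<Rightarrow> bool" where
  "spd A \<longleftrightarrow> transpose A = A \<and> (\<forall>x. x \<noteq> 0 \<longrightarrow> x \<bullet> (A *v x) > 0)"

definition M_inner :: "real^'n^'n \<Rightarrow> real^'n \<Rightarrow> real^'n \<Rightarrow> real" where
  "M_inner M x y = x \<bullet> (M *v y)"

definition M_norm :: "real^'n^'n \<Rightarrow> real^'n \<Rightarrow> real" where
  "M_norm M x = sqrt (M_inner M x x)"

definition Rq :: "real^'n^'n \<Rightarrow> real^'n^'n \<Rightarrow> real^'n \<Rightarrow> real" where
  "Rq A M x = (x \<bullet> (A *v x)) / (x \<bullet> (M *v x))"

definition pencil_eigenvalues :: "real^'n^'n \<Rightarrow> real^'n^'n \<Rightarrow> real set" where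
  "pencil_eigenvalues B P = {\<xi>. \<exists>v. v \<noteq> 0 \<and> B *v v = \<xi> *\<^sub>R (P *v v)}"

text \<open>
  Indices run from 1 to n = \<open>CARD('n)\<close>; other values of \<open>lam\<close> and \<open>u\<close> are irrelevant.
  Since there are n M-orthonormal eigenvectors, \<open>lam 1, ..., lam n\<close> are all the eigenvalues
  of the pencil, repeated according to multiplicity.
\<close>
definition pencil_eigensystem ::
    "real^'n^'n \<Rightarrow> real^'n^'n \<Rightarrow> (nat \<Rightarrow> real) \<Rightarrow> (nat \<Rightarrow> real^'n) \<Rightarrow> bool" where
  "pencil_eigensystem A M lam u \<longleftrightarrow>
     mono_on {1..CARD('n)} lam \<and>
     (\<forall>i\<in>{1..CARD('n)}. A *v u i = lam i *\<^sub>R (M *v u i) \<and> M_norm M (u i) = 1) \<and>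
     (\<forall>i\<in>{1..CARD('n)}. \<forall>j\<in>{1..CARD('n)}. i \<noteq> j \<longrightarrow> M_inner M (u i) (u j) = 0)"

text \<open>The matrix [q, Q]: column \<open>None\<close> is q, column \<open>Some j\<close> is the j-th column of Q.\<close>
definition prepend_column :: "real^'n \<Rightarrow> real^'m^'n \<Rightarrow> real^('m option)^'n" where
  "prepend_column q Q = (\<chi> i j. case j of None \<Rightarrow> q $ i | Some k \<Rightarrow> Q $ i $ k)"

definition sublevel_X :: "real^'n^'n \<Rightarrow> real^'n^'n \<Rightarrow> real^'n \<Rightarrow> (real^'n) set" where
  "sublevel_X A M q = {x. M_norm M x = 1 \<and> M_inner M q x > 0 \<and> Rq A M x \<le> Rq A M q}"

definition chi_P :: "real \<Rightarrow> real \<Rightarrow> real \<Rightarrow> real \<Rightarrow> real" where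
  "chi_P l1 l2 \<xi>min \<xi>max =
     8 * l2 / l1 * (\<xi>max / \<xi>min) * sqrt ((l2 + l1) / (2 * (l2 - l1)))"

definition mu_P :: "real \<Rightarrow> real \<Rightarrow> real \<Rightarrow> real \<Rightarrow> real \<Rightarrow> real" where
  "mu_P l1 l2 \<xi>min \<xi>max \<rho> =
     2 * \<xi>min * (1 - 4 * (\<rho> - l1) / (l2 - l1)) *
     (1 - l1 / l2 - (2 + chi_P l1 l2 \<xi>min \<xi>max) / l2 * (\<rho> - l1))"

definition L_P :: "real \<Rightarrow> real \<Rightarrow> real \<Rightarrow> real \<Rightarrow> real \<Rightarrow> real \<Rightarrow> real" where
  "L_P l1 l2 lN \<xi>min \<xi>max \<rho> =
     2 * \<xi>max * (1 - l1 / lN + chi_P l1 l2 \<xi>min \<xi>max / l2 * (\<xi>min / \<xi>max) * (\<rho> - l1))"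

text \<open>The matrix \<open>\<chi> i j. \<dots>\<close> is the rank-one matrix with column factor \<open>qt\<close> and row factor \<open>q v* M\<close>.\<close>
definition proj_Pi :: "real^'n^'n \<Rightarrow> real^'n^'n \<Rightarrow> real^'n \<Rightarrow> real^'n^'n" where
  "proj_Pi M T q =
     (let qt = matrix_inv T *v (M *v q) in
      mat 1 - (1 / M_inner M q qt) *\<^sub>R (\<chi> i j. qt $ i * (q v* M) $ j))"

definition residual :: "real^'n^'n \<Rightarrow> real^'n^'n \<Rightarrow> real^'n \<Rightarrow> real^'n" where
  "residual A M x = 2 *\<^sub>R (A *v x - Rq A M x *\<^sub>R (M *v x))"

definition prec_residual ::
    "real^'n^'n \<Rightarrow> real^'n^'n \<Rightarrow> real^'n^'n \<Rightarrow> real^'n \<Rightarrow> real^'n \<Rightarrow> real^'n" where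
  "prec_residual A M T q x = proj_Pi M T q *v (matrix_inv T *v residual A M x)"

text \<open>
  One iteration, from \<open>(x, z)\<close> to \<open>(x', z')\<close>. Minimizers need not be unique, so the arg min
  is a relation: any minimizer is allowed.
\<close>
definition epic_step ::
    "real^'n^'n \<Rightarrow> real^'n^'n \<Rightarrow> real^'n^'n \<Rightarrow> real^'n \<Rightarrow> real \<Rightarrow> real \<Rightarrow>
     real^'n \<Rightarrow> real^'n \<Rightarrow> real^'n \<Rightarrow> real^'n \<Rightarrow> bool" where
  "epic_step A M T q \<tau> \<mu> x z x' z' \<longleftrightarrow>
     (\<exists>xb rt \<eta>1 \<eta>2. \<eta>1 > 0 \<and> \<eta>2 > 0 \<and>
        xb = (1 / \<eta>1) *\<^sub>R ((1 / M_inner M q x) *\<^sub>R x + (\<tau> / M_inner M q z) *\<^sub>R z) \<and>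
        M_norm M xb = 1 \<and>
        rt = prec_residual A M T q xb \<and>
        z' = (1 / \<eta>2) *\<^sub>R (((1 - \<tau>) / M_inner M q z) *\<^sub>R z + (\<tau> / M_inner M q xb) *\<^sub>R xb
                            - (\<tau> * M_inner M q xb / \<mu>) *\<^sub>R rt) \<and>
        M_norm M z' = 1 \<and>
        is_arg_min (Rq A M) (\<lambda>y. y \<in> sublevel_X A M q \<inter> span {q, x, xb, rt}) x')"

definition epic_iteration ::
    "real^'n^'n \<Rightarrow> real^'n^'n \<Rightarrow> real^'n^'n \<Rightarrow> real^'n \<Rightarrow> real \<Rightarrow> real \<Rightarrow>
     (nat \<Rightarrow> real^'n) \<Rightarrow> (nat \<Rightarrow> real^'n) \<Rightarrow> bool" where
  "epic_iteration A M T q \<tau> \<mu> x z \<longleftrightarrow>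
     (\<forall>k. epic_step A M T q \<tau> \<mu> (x k) (z k) (x (Suc k)) (z (Suc k)))"

end

theory Submission
  imports Defs
begin

text \<open>
  Normalizing by \<open>q\<^sup>T M x = 1\<close> turns EPIC into Nesterov's accelerated gradient method, in the norm of
  \<open>T\<close>, for the Rayleigh quotient on the sublevel set \<open>W\<close> of an affine hyperplane: there the projected
  preconditioned residual is the \<open>T\<close>-gradient, and the exact line search does at least as well as a
  gradient step of length \<open>1 / L\<close>. The set \<open>W\<close> is convex, and on it the Hessian of the Rayleigh
  quotient lies between \<open>\<mu> T\<close> and \<open>L T\<close>, so the energy
  \<open>Rq x - \<lambda>\<^sub>1 + \<mu>/2 \<parallel>z - x\<^sub>*\<parallel>\<^sub>T\<^sup>2\<close>, where \<open>x\<^sub>*\<close> is the multiple of \<open>u\<^sub>1\<close> in the hyperplane, contracts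
  by \<open>1 - \<tau>\<close> as long as \<open>z\<close> stays in \<open>W\<close>. The bound on the initial energy ensures this, since a
  \<open>T\<close>-ball around \<open>x\<^sub>*\<close> of squared radius \<open>\<delta> / L\<close>, \<open>\<delta> = \<rho> - \<lambda>\<^sub>1\<close>, is contained in \<open>W\<close>.
\<close>

\<comment> \<open>Otherwise the simplifier turns \<open>u 1\<close> into \<open>u (Suc 0)\<close>, and facts about \<open>u 1\<close> no longer match.\<close>
declare One_nat_def [simp del]

section \<open>Symmetric bilinear forms and Cauchy-Schwarz\<close>

lemma M_inner_simps:
  "M_inner M (x + y) z = M_inner M x z + M_inner M y z"
  "M_inner M x (y + z) = M_inner M x y + M_inner M x z"
  "M_inner M (x - y) z = M_inner M x z - M_inner M y z"
  "M_inner M x (y - z) = M_inner M x y - M_inner M x z"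
  "M_inner M (c *\<^sub>R x) y = c * M_inner M x y"
  "M_inner M x (c *\<^sub>R y) = c * M_inner M x y"
  "M_inner M 0 x = 0" "M_inner M x 0 = 0"
  by (simp_all add: M_inner_def inner_add_left inner_diff_left inner_add_right inner_diff_right
      matrix_vector_right_distrib matrix_vector_mult_diff_distrib matrix_vector_mult_scaleR)

lemma M_inner_minus:
  "M_inner M (- x) y = - M_inner M x y" "M_inner M x (- y) = - M_inner M x y"
  using M_inner_simps(3)[of M 0 x y] M_inner_simps(4)[of M x 0 y] by (simp_all add: M_inner_simps)

lemma M_inner_sum:
  "M_inner M (\<Sum>i\<in>S. f i) y = (\<Sum>i\<in>S. M_inner M (f i) y)"
  by (simp add: M_inner_def inner_sum_left)

lemma M_inner_matrix_simps:
  "M_inner (A - B) x y = M_inner A x y - M_inner B x y"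
  "M_inner (c *\<^sub>R A) x y = c * M_inner A x y"
  by (simp_all add: M_inner_def matrix_vector_mult_diff_rdistrib inner_diff_right
      scaleR_matrix_vector_assoc[symmetric])

lemma M_inner_commute:
  assumes "transpose M = M"
  shows "M_inner M x y = M_inner M y x"
proof -
  have "M_inner M x y = (transpose M *v x) \<bullet> y"
    by (simp add: M_inner_def dot_lmul_matrix)
  then show ?thesis
    using assms by (simp add: M_inner_def inner_commute)
qed

lemma M_inner_congruence:
  "M_inner (transpose Q ** A ** Q) v w = M_inner A (Q *v v) (Q *v w)"
proof -
  have "M_inner A (Q *v v) (Q *v w) = (v v* transpose Q) \<bullet> (A *v (Q *v w))"
    by (simp add: M_inner_def)
  also have "\<dots> = v \<bullet> (transpose Q *v (A *v (Q *v w)))"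
    by (rule dot_lmul_matrix)
  finally show ?thesis
    by (simp add: M_inner_def matrix_vector_mul_assoc matrix_mul_assoc)
qed

lemma spd_M_inner_commute: "spd M \<Longrightarrow> M_inner M x y = M_inner M y x"
  by (simp add: spd_def M_inner_commute)

lemma spd_M_inner_pos: "spd M \<Longrightarrow> x \<noteq> 0 \<Longrightarrow> 0 < M_inner M x x"
  by (simp add: spd_def M_inner_def)

lemma spd_M_inner_nonneg: "spd M \<Longrightarrow> 0 \<le> M_inner M x x"
  by (cases "x = 0") (simp_all add: M_inner_simps spd_M_inner_pos less_imp_le)

lemma spd_M_inner_eq_0: "spd M \<Longrightarrow> M_inner M x x = 0 \<longleftrightarrow> x = 0"
  using spd_M_inner_pos[of M x] by (cases "x = 0") (auto simp: M_inner_simps)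

lemma M_norm_eq_1: "M_norm M x = 1 \<longleftrightarrow> M_inner M x x = 1"
  by (simp add: M_norm_def real_sqrt_eq_1_iff)

text \<open>The form may be degenerate, so neither diagonal value can be divided by outright. If one
  of them is positive, the usual quadratic gives the claim; if both vanish, the values at
  \<open>x + y\<close> and \<open>x - y\<close> force the mixed value to be zero.\<close>

lemma psd_Cauchy_Schwarz:
  assumes sym: "transpose S = S" and psd: "\<And>x. 0 \<le> M_inner S x x"
  shows "(M_inner S x y)\<^sup>2 \<le> M_inner S x x * M_inner S y y"
proof -
  define a b c where abc: "a = M_inner S x x" "b = M_inner S x y" "c = M_inner S y y"
  have yx: "M_inner S y x = b"
    using M_inner_commute[OF sym] by (simp add: abc)
  have "0 \<le> M_inner S (c *\<^sub>R x - b *\<^sub>R y) (c *\<^sub>R x - b *\<^sub>R y)" by (rule psd)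
  then have 1: "0 \<le> c * (a * c - b\<^sup>2)"
    by (simp add: M_inner_simps yx abc[symmetric] algebra_simps power2_eq_square)
  have "0 \<le> M_inner S (a *\<^sub>R y - b *\<^sub>R x) (a *\<^sub>R y - b *\<^sub>R x)" by (rule psd)
  then have 2: "0 \<le> a * (a * c - b\<^sup>2)"
    by (simp add: M_inner_simps yx abc[symmetric] algebra_simps power2_eq_square)
  have 3: "0 \<le> a + 2 * b + c"
    using psd[of "x + y"] by (simp add: M_inner_simps yx abc[symmetric])
  have 4: "0 \<le> a - 2 * b + c"
    using psd[of "x - y"] by (simp add: M_inner_simps yx abc[symmetric])
  have "0 \<le> a" "0 \<le> c" using psd by (simp_all add: abc)
  then consider "0 < a" | "0 < c" | "a = 0" "c = 0" by linarith
  then have "b\<^sup>2 \<le> a * c"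
  proof cases
    case 1 with 2 show ?thesis by (simp add: zero_le_mult_iff)
  next
    case 2 with 1 show ?thesis by (simp add: zero_le_mult_iff)
  next
    case 3 with \<open>0 \<le> a + 2 * b + c\<close> 4 show ?thesis by simp
  qed
  then show ?thesis by (simp add: abc)
qed

lemma spd_Cauchy_Schwarz:
  "spd M \<Longrightarrow> (M_inner M x y)\<^sup>2 \<le> M_inner M x x * M_inner M y y"
  by (rule psd_Cauchy_Schwarz) (auto simp: spd_M_inner_nonneg spd_def)

lemma spd_orthogonal_independent:
  assumes "spd M" "0 \<notin> S" "\<And>x y. x \<in> S \<Longrightarrow> y \<in> S \<Longrightarrow> x \<noteq> y \<Longrightarrow> M_inner M x y = 0"
  shows "independent S"
  unfolding dependent_def
proof
  assume "\<exists>a\<in>S. a \<in> span (S - {a})"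
  then obtain a where a: "a \<in> S" "a \<in> span (S - {a})" by blast
  have "subspace {y. M_inner M a y = 0}"
    by (auto simp: subspace_def M_inner_simps)
  moreover have "S - {a} \<subseteq> {y. M_inner M a y = 0}"
    using a assms(3) by auto
  ultimately have "M_inner M a a = 0"
    using a(2) span_minimal by blast
  then show False
    using assms a by (auto simp: spd_M_inner_eq_0)
qed

lemma Rq_scaleR: "c \<noteq> 0 \<Longrightarrow> Rq A M (c *\<^sub>R x) = Rq A M x"
  by (simp add: Rq_def matrix_vector_mult_scaleR)

lemma M_inner_eq_Rq: "spd M \<Longrightarrow> M_inner A x x = Rq A M x * M_inner M x x"
  using spd_M_inner_pos[of M x] by (cases "x = 0") (auto simp: Rq_def M_inner_def)

lemma Rq_le_iff: "spd M \<Longrightarrow> x \<noteq> 0 \<Longrightarrow> Rq A M x \<le> r \<longleftrightarrow> M_inner A x x \<le> r * M_inner M x x"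
  using spd_M_inner_pos[of M x] by (simp add: Rq_def M_inner_def[symmetric] divide_le_eq)

section \<open>Extreme eigenvalues of a definite pencil\<close>

lemma finite_pencil_eigenvalues:
  fixes P B :: "real^'m^'m"
  assumes P: "spd P" and B: "transpose B = B"
  shows "finite (pencil_eigenvalues B P)"
proof -
  \<comment> \<open>One eigenvector is chosen per eigenvalue. Distinct eigenvalues give
    \<open>P\<close>-orthogonal, hence independent, vectors, of which there are finitely many.
    Finiteness makes \<open>Min\<close> and \<open>Max\<close> attained extrema.\<close>
  define V where "V \<xi> = (SOME v. v \<noteq> 0 \<and> B *v v = \<xi> *\<^sub>R (P *v v))" for \<xi>
  have V: "V \<xi> \<noteq> 0" "B *v V \<xi> = \<xi> *\<^sub>R (P *v V \<xi>)" if "\<xi> \<in> pencil_eigenvalues B P" for \<xi>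
    using someI_ex[of "\<lambda>v. v \<noteq> 0 \<and> B *v v = \<xi> *\<^sub>R (P *v v)"] that
    by (auto simp: V_def pencil_eigenvalues_def)
  have orth: "M_inner P (V a) (V b) = 0"
    if "a \<in> pencil_eigenvalues B P" "b \<in> pencil_eigenvalues B P" "a \<noteq> b" for a b
  proof -
    have "M_inner B (V a) (V b) = b * M_inner P (V a) (V b)"
      "M_inner B (V b) (V a) = a * M_inner P (V b) (V a)"
      using V that by (simp_all add: M_inner_def)
    then show ?thesis
      using that spd_M_inner_commute[OF P, of "V a"] M_inner_commute[OF B, of "V a"] by auto
  qed
  have "inj_on V (pencil_eigenvalues B P)"
  proof (rule inj_onI, rule ccontr)
    fix a b assume ab: "a \<in> pencil_eigenvalues B P" "b \<in> pencil_eigenvalues B P" "V a = V b" "a \<noteq> b"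
    then have "M_inner P (V a) (V a) = 0" using orth[of a b] by simp
    then show False using V ab P by (simp add: spd_M_inner_eq_0)
  qed
  moreover have "independent (V ` pencil_eigenvalues B P)"
    by (rule spd_orthogonal_independent[OF P]) (use V orth in auto)
  then have "finite (V ` pencil_eigenvalues B P)"
    by (rule independent_imp_finite)
  ultimately show ?thesis by (simp add: finite_image_iff)
qed

text \<open>The quotient attains a minimum \<open>\<xi>\<close> on the Euclidean unit sphere. There
  the form of \<open>B - \<xi> *\<^sub>R P\<close> is semidefinite and vanishes at the minimizer, so
  Cauchy-Schwarz puts the minimizer into the kernel; no derivative is taken.\<close>

lemma pencil_min_eigenvalue:
  fixes P B :: "real^'m^'m"
  assumes P: "spd P" and B: "transpose B = B"
  obtains \<xi> where "\<xi> \<in> pencil_eigenvalues B P"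
    "\<And>w. \<xi> * M_inner P w w \<le> M_inner B w w"
proof -
  have "continuous_on (sphere 0 1) (\<lambda>x. M_inner B x x / M_inner P x x)"
  proof (intro continuous_intros ballI)
    fix x :: "real^'m" assume "x \<in> sphere 0 1"
    then have "x \<noteq> 0" by auto
    then show "M_inner P x x \<noteq> 0" using P by (simp add: spd_M_inner_eq_0)
  qed (auto simp: M_inner_def intro!: continuous_intros matrix_vector_mult_linear_continuous_on)
  moreover have "axis undefined 1 \<in> (sphere 0 1 :: (real^'m) set)"
    by simp
  then have "sphere 0 1 \<noteq> ({} :: (real^'m) set)" by blast
  ultimately obtain v where v: "v \<in> sphere 0 (1::real)"
    and min: "\<And>x. x \<in> sphere 0 1 \<Longrightarrow> M_inner B v v / M_inner P v v \<le> M_inner B x x / M_inner P x x"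
    using continuous_attains_inf[OF compact_sphere] by blast
  define \<xi> where "\<xi> = M_inner B v v / M_inner P v v"
  have v0: "v \<noteq> 0" using v by auto
  have bound: "\<xi> * M_inner P w w \<le> M_inner B w w" for w
  proof (cases "w = 0")
    case False
    have "\<xi> \<le> M_inner B (w /\<^sub>R norm w) (w /\<^sub>R norm w) / M_inner P (w /\<^sub>R norm w) (w /\<^sub>R norm w)"
      unfolding \<xi>_def using False by (intro min) auto
    also have "\<dots> = M_inner B w w / M_inner P w w"
      using False by (simp add: M_inner_simps)
    finally show ?thesis using spd_M_inner_pos[OF P False] by (simp add: field_simps)
  qed (simp add: M_inner_simps)
  have sym: "transpose (B - \<xi> *\<^sub>R P) = B - \<xi> *\<^sub>R P"
    using P B by (simp add: spd_def transpose_def vec_eq_iff)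
  have "(M_inner (B - \<xi> *\<^sub>R P) w v)\<^sup>2 \<le> 0" for w
  proof -
    have "M_inner (B - \<xi> *\<^sub>R P) v v = 0"
      using spd_M_inner_pos[OF P v0] by (simp add: M_inner_matrix_simps \<xi>_def)
    then show ?thesis
      using psd_Cauchy_Schwarz[OF sym, of w v] bound by (simp add: M_inner_matrix_simps)
  qed
  \<comment> \<open>With this choice of \<open>w\<close> the mixed value is the squared Euclidean
    norm of \<open>w\<close> itself.\<close>
  from this[of "(B - \<xi> *\<^sub>R P) *v v"] have "(B - \<xi> *\<^sub>R P) *v v = 0"
    by (simp add: M_inner_def)
  then have "B *v v = \<xi> *\<^sub>R (P *v v)"
    by (simp add: matrix_vector_mult_diff_rdistrib scaleR_matrix_vector_assoc[symmetric])
  then have "\<xi> \<in> pencil_eigenvalues B P"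
    using v0 by (auto simp: pencil_eigenvalues_def)
  then show ?thesis using bound that by blast
qed

lemma uminus_pencil_eigenvalues:
  assumes "\<xi> \<in> pencil_eigenvalues (- B) P"
  shows "- \<xi> \<in> pencil_eigenvalues B P"
proof -
  obtain v where v: "v \<noteq> 0" "(- B) *v v = \<xi> *\<^sub>R (P *v v)"
    using assms by (auto simp: pencil_eigenvalues_def)
  have "(- B) *v v = - (B *v v)"
    using matrix_vector_mult_diff_rdistrib[of 0 B v] by simp
  then have "- (B *v v) = \<xi> *\<^sub>R (P *v v)"
    using v(2) by simp
  then have "B *v v = (- \<xi>) *\<^sub>R (P *v v)"
    by (metis minus_minus scaleR_minus_left)
  then show ?thesis using v(1) unfolding pencil_eigenvalues_def by blast
qed

lemma pencil_eigenvalue_bounds: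
  fixes P B :: "real^'m^'m"
  assumes P: "spd P" and B: "spd B"
  defines "E \<equiv> pencil_eigenvalues B P"
  shows "0 < Min E" "Min E \<le> Max E"
    "\<And>w. Min E * M_inner P w w \<le> M_inner B w w"
    "\<And>w. M_inner B w w \<le> Max E * M_inner P w w"
proof -
  have sym: "transpose B = B" "transpose (- B) = - B"
    using B by (auto simp: spd_def transpose_def vec_eq_iff)
  have fin: "finite E" unfolding E_def by (rule finite_pencil_eigenvalues[OF P sym(1)])
  obtain a where a: "a \<in> E" "\<And>w. a * M_inner P w w \<le> M_inner B w w"
    using pencil_min_eigenvalue[OF P sym(1)] E_def by metis
  \<comment> \<open>The largest eigenvalue is minus the smallest eigenvalue of the pencil with
    \<open>B\<close> negated.\<close>
  obtain b where "b \<in> pencil_eigenvalues (- B) P" "\<And>w. b * M_inner P w w \<le> M_inner (- B) w w"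
    using pencil_min_eigenvalue[OF P sym(2)] by metis
  then have b: "- b \<in> E" "\<And>w. b * M_inner P w w \<le> - M_inner B w w"
    using M_inner_matrix_simps(1)[of 0 B]
    by (auto simp: E_def M_inner_def intro: uminus_pencil_eigenvalues)
  have val: "\<exists>v. v \<noteq> 0 \<and> M_inner B v v = \<xi> * M_inner P v v" if "\<xi> \<in> E" for \<xi>
    using that by (auto simp: E_def pencil_eigenvalues_def M_inner_def)
  have pos: "0 < \<xi>" if "\<xi> \<in> E" for \<xi>
    using val[OF that] spd_M_inner_pos[OF P] spd_M_inner_pos[OF B]
    by (metis zero_less_mult_pos2)
  have "Min E = a"
  proof (rule Min_eqI[OF fin _ a(1)])
    fix \<xi> assume "\<xi> \<in> E"
    then obtain v where "v \<noteq> 0" "M_inner B v v = \<xi> * M_inner P v v" using val by blast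
    then show "a \<le> \<xi>" using a(2)[of v] spd_M_inner_pos[OF P] by simp
  qed
  moreover have "Max E = - b"
  proof (rule Max_eqI[OF fin _ b(1)])
    fix \<xi> assume "\<xi> \<in> E"
    then obtain v where v: "v \<noteq> 0" "M_inner B v v = \<xi> * M_inner P v v" using val by blast
    have "b * M_inner P v v \<le> (- \<xi>) * M_inner P v v" using b(2)[of v] v by simp
    then have "b \<le> - \<xi>" using spd_M_inner_pos[OF P v(1)] by (rule mult_right_le_imp_le)
    then show "\<xi> \<le> - b" by simp
  qed
  moreover have "a \<le> - b"
    using calculation fin b(1) by auto
  moreover have "M_inner B w w \<le> - b * M_inner P w w" for w
    using b(2)[of w] by simp
  ultimately show "0 < Min E" "Min E \<le> Max E"
    "\<And>w. Min E * M_inner P w w \<le> M_inner B w w"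
    "\<And>w. M_inner B w w \<le> Max E * M_inner P w w"
    using a(2) pos[OF a(1)] by simp_all
qed


section \<open>The Rayleigh quotient along a line\<close>

definition dRq :: "real^'n^'n \<Rightarrow> real^'n^'n \<Rightarrow> real^'n \<Rightarrow> real^'n \<Rightarrow> real" where
  "dRq A M x v = 2 * (M_inner A v x - Rq A M x * M_inner M v x) / M_inner M x x"

text \<open>The second derivative along a line in direction \<open>v\<close>. Keeping
  \<open>dRq\<close> as a factor isolates the mixed term, which is estimated on its own in
  \<open>hessian_mixed_term\<close>.\<close>

definition d2Rq :: "real^'n^'n \<Rightarrow> real^'n^'n \<Rightarrow> real^'n \<Rightarrow> real^'n \<Rightarrow> real" where
  "d2Rq A M x v =
     2 * (M_inner A v v - Rq A M x * M_inner M v v - 2 * dRq A M x v * M_inner M v x) / M_inner M x x"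

lemma M_inner_line:
  assumes "transpose A = A"
  shows "M_inner A (x + t *\<^sub>R v) (x + t *\<^sub>R v) =
    M_inner A x x + 2 * t * M_inner A v x + t\<^sup>2 * M_inner A v v"
  using M_inner_commute[OF assms, of x v] by (simp add: M_inner_simps power2_eq_square algebra_simps)

lemma has_derivative_M_inner_line:
  assumes "transpose A = A"
  shows "((\<lambda>t. M_inner A (x + t *\<^sub>R v) (x + t *\<^sub>R v)) has_real_derivative
    2 * M_inner A v (x + t *\<^sub>R v)) (at t)"
    "((\<lambda>t. M_inner A v (x + t *\<^sub>R v)) has_real_derivative M_inner A v v) (at t)"
  unfolding M_inner_line[OF assms]
  by (auto intro!: derivative_eq_intros simp: M_inner_simps algebra_simps)

context
  fixes A M :: "real^'n^'n" and x v :: "real^'n" and t :: real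
  assumes A: "transpose A = A" and M: "spd M" and nz: "x + t *\<^sub>R v \<noteq> 0"
begin

lemma has_derivative_Rq_line:
  "((\<lambda>t. Rq A M (x + t *\<^sub>R v)) has_real_derivative dRq A M (x + t *\<^sub>R v) v) (at t)"
proof -
  let ?y = "x + t *\<^sub>R v"
  have Msym: "transpose M = M" using M by (simp add: spd_def)
  have D: "M_inner M ?y ?y \<noteq> 0" using M nz by (simp add: spd_M_inner_eq_0)
  have "dRq A M ?y v = (2 * M_inner A v ?y * M_inner M ?y ?y - M_inner A ?y ?y * (2 * M_inner M v ?y))
      / (M_inner M ?y ?y * M_inner M ?y ?y)"
    using D by (simp add: dRq_def Rq_def M_inner_def[symmetric] divide_simps)
  then show ?thesis
    unfolding Rq_def M_inner_def[symmetric]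
    using DERIV_divide[OF has_derivative_M_inner_line(1)[OF A] has_derivative_M_inner_line(1)[OF Msym] D]
    by simp
qed

lemma has_derivative_dRq_line:
  "((\<lambda>t. dRq A M (x + t *\<^sub>R v) v) has_real_derivative d2Rq A M (x + t *\<^sub>R v) v) (at t)"
proof -
  let ?y = "x + t *\<^sub>R v"
  have Msym: "transpose M = M" using M by (simp add: spd_def)
  have D: "M_inner M ?y ?y \<noteq> 0" using M nz by (simp add: spd_M_inner_eq_0)
  have "((\<lambda>t. dRq A M (x + t *\<^sub>R v) v) has_real_derivative
     (2 * (M_inner A v v - (dRq A M ?y v * M_inner M v ?y + M_inner M v v * Rq A M ?y)) * M_inner M ?y ?y
       - 2 * (M_inner A v ?y - Rq A M ?y * M_inner M v ?y) * (2 * M_inner M v ?y))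
      / (M_inner M ?y ?y * M_inner M ?y ?y)) (at t)"
    unfolding dRq_def[of A M "x + _ *\<^sub>R v"]
    by (intro DERIV_divide DERIV_cmult DERIV_diff DERIV_mult has_derivative_M_inner_line[OF A]
        has_derivative_M_inner_line[OF Msym] D has_derivative_Rq_line[unfolded dRq_def[of A M "x + _ *\<^sub>R v"]])
  also have "(2 * (M_inner A v v - (dRq A M ?y v * M_inner M v ?y + M_inner M v v * Rq A M ?y)) * M_inner M ?y ?y
       - 2 * (M_inner A v ?y - Rq A M ?y * M_inner M v ?y) * (2 * M_inner M v ?y))
      / (M_inner M ?y ?y * M_inner M ?y ?y) = d2Rq A M ?y v"
  proof -
    have "2 * (M_inner A v ?y - Rq A M ?y * M_inner M v ?y) = dRq A M ?y v * M_inner M ?y ?y"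
      using D by (simp add: dRq_def)
    \<comment> \<open>Once the numerator left by the quotient rule is expressed through
      \<open>dRq\<close> times the denominator \<open>D\<close>, one factor \<open>D\<close>
      cancels.\<close>
    moreover have "(2 * (F - (d * m + G * f)) * D - d * D * (2 * m)) / (D * D) =
        2 * (F - f * G - 2 * d * m) / D" if "D \<noteq> 0" for F G D d m f :: real
      using that by (simp add: divide_eq_eq eq_divide_eq) (simp add: algebra_simps)
    ultimately show ?thesis
      using D by (simp only: d2Rq_def not_False_eq_True)
  qed
  finally show ?thesis .
qed

end

section \<open>Spectral bounds\<close>

locale spd_pencil =
  fixes A M :: "real^'n^'n" and lam :: "nat \<Rightarrow> real" and u :: "nat \<Rightarrow> real^'n"
  assumes A: "spd A" and M: "spd M"
    and eig: "pencil_eigensystem A M lam u"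
    and card_ge_2: "2 \<le> CARD('n)"
    and lam1_pos: "0 < lam 1" and lam12: "lam 1 < lam 2"
begin

lemma Asym: "transpose A = A" and Msym: "transpose M = M"
  using A M by (auto simp: spd_def)

lemmas Mc = M_inner_commute[OF Msym] and Ac = M_inner_commute[OF Asym]

lemma A_u: "i \<in> {1..CARD('n)} \<Longrightarrow> M_inner A x (u i) = lam i * M_inner M x (u i)"
  using eig by (simp add: pencil_eigensystem_def M_inner_def)

lemma M_u_u: "i \<in> {1..CARD('n)} \<Longrightarrow> j \<in> {1..CARD('n)} \<Longrightarrow> M_inner M (u i) (u j) = (if i = j then 1 else 0)"
  using eig by (auto simp: pencil_eigensystem_def M_norm_eq_1)

lemma lam_le: "i \<in> {1..CARD('n)} \<Longrightarrow> j \<in> {1..CARD('n)} \<Longrightarrow> i \<le> j \<Longrightarrow> lam i \<le> lam j"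
  using eig by (auto simp: pencil_eigensystem_def mono_on_def)

lemma span_u: "span (u ` {1..CARD('n)}) = UNIV"
proof -
  have inj: "inj_on u {1..CARD('n)}"
    by (rule inj_onI, rule ccontr) (metis M_u_u zero_neq_one)
  have "independent (u ` {1..CARD('n)})"
  proof (rule spd_orthogonal_independent[OF M])
    show "0 \<notin> u ` {1..CARD('n)}"
      using M_u_u by (force simp: M_inner_simps)
  qed (use M_u_u in auto)
  then have "dim (u ` {1..CARD('n)}) = CARD('n)"
    using dim_eq_card_independent card_image[OF inj] by fastforce
  then show ?thesis
    by (subst dim_eq_full[symmetric]) simp
qed

lemma eigen_expansion: "x = (\<Sum>i\<in>{1..CARD('n)}. M_inner M (u i) x *\<^sub>R u i)"
proof -
  define d where "d = x - (\<Sum>i\<in>{1..CARD('n)}. M_inner M (u i) x *\<^sub>R u i)"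
  have "M_inner M d (u j) = 0" if "j \<in> {1..CARD('n)}" for j
  proof -
    have "M_inner M (\<Sum>i\<in>{1..CARD('n)}. M_inner M (u i) x *\<^sub>R u i) (u j) =
        (\<Sum>i\<in>{1..CARD('n)}. if i = j then M_inner M (u i) x else 0)"
      unfolding M_inner_sum using that by (intro sum.cong) (auto simp: M_inner_simps M_u_u)
    also have "\<dots> = M_inner M (u j) x" using that by simp
    finally show ?thesis by (simp add: d_def M_inner_simps Mc[of x])
  qed
  moreover have "subspace {y. M_inner M d y = 0}"
    by (auto simp: subspace_def M_inner_simps)
  ultimately have "span (u ` {1..CARD('n)}) \<subseteq> {y. M_inner M d y = 0}"
    by (intro span_minimal) auto
  then have "d = 0"
    using span_u spd_M_inner_eq_0[OF M, of d] by blast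
  then show ?thesis by (simp add: d_def)
qed

lemma M_inner_expansion: "M_inner M x y = (\<Sum>i\<in>{1..CARD('n)}. M_inner M (u i) x * M_inner M (u i) y)"
  by (subst eigen_expansion[of x]) (simp add: M_inner_sum M_inner_simps)

lemma A_inner_expansion: "M_inner A x y = (\<Sum>i\<in>{1..CARD('n)}. lam i * (M_inner M (u i) x * M_inner M (u i) y))"
proof -
  have "M_inner A x y = (\<Sum>i\<in>{1..CARD('n)}. M_inner M (u i) x * M_inner A (u i) y)"
    by (subst eigen_expansion[of x]) (simp add: M_inner_sum M_inner_simps)
  also have "\<dots> = (\<Sum>i\<in>{1..CARD('n)}. lam i * (M_inner M (u i) x * M_inner M (u i) y))"
    by (intro sum.cong) (auto simp: Ac[of "u _"] A_u Mc[of y])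
  finally show ?thesis .
qed

lemma A_ge_lam1: "lam 1 * M_inner M x x \<le> M_inner A x x"
  unfolding M_inner_expansion[of x x] A_inner_expansion[of x x] sum_distrib_left
  using lam_le card_ge_2 by (intro sum_mono mult_right_mono) auto

lemma A_le_lamn: "M_inner A x x \<le> lam CARD('n) * M_inner M x x"
  unfolding M_inner_expansion[of x x] A_inner_expansion[of x x] sum_distrib_left
  using lam_le card_ge_2 by (intro sum_mono mult_right_mono) auto

text \<open>Every eigenvalue but the first is at least \<open>lam 2\<close>, and the subtracted term
  corrects the share of \<open>u 1\<close>. All uses of the spectral gap in the chart go back to
  this inequality.\<close>

lemma A_ge_lam2: "lam 2 * M_inner M x x - (lam 2 - lam 1) * (M_inner M (u 1) x)\<^sup>2 \<le> M_inner A x x"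
proof -
  define c where "c i = M_inner M (u i) x" for i
  have split: "{1..CARD('n)} = insert 1 {2..CARD('n)}" using card_ge_2 by auto
  have "lam 2 * (\<Sum>i\<in>{2..CARD('n)}. c i * c i) \<le> (\<Sum>i\<in>{2..CARD('n)}. lam i * (c i * c i))"
    unfolding sum_distrib_left
  proof (intro sum_mono mult_right_mono)
    show "lam 2 \<le> lam i" if "i \<in> {2..CARD('n)}" for i
      using lam_le[of 2 i] that by simp
  qed simp
  then show ?thesis
    unfolding M_inner_expansion[of x x] A_inner_expansion[of x x] split c_def[symmetric]
    by (simp add: power2_eq_square algebra_simps)
qed

lemma lam2_le_lamn: "lam 2 \<le> lam CARD('n)"
  using lam_le card_ge_2 by simp

lemma Rq_ge_lam1: "x \<noteq> 0 \<Longrightarrow> lam 1 \<le> Rq A M x"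
  using A_ge_lam1[of x] spd_M_inner_pos[OF M, of x]
  by (simp add: Rq_def M_inner_def[symmetric] le_divide_eq)

lemma Rq_u1: "Rq A M (u 1) = lam 1"
  using A_u[of 1 "u 1"] M_u_u[of 1 1] card_ge_2 by (simp add: Rq_def M_inner_def)

text \<open>Cauchy-Schwarz in eigencoordinates with weights \<open>sqrt (lam i)\<close>: one factor
  is the \<open>A\<close>-form of \<open>v\<close>, the other the squared norm of the residual in
  the inverse of \<open>A\<close>. The latter is small when \<open>f\<close> is close to
  \<open>lam 1\<close>.\<close>

lemma residual_bound:
  fixes x v :: "real^'n"
  defines "f \<equiv> Rq A M x"
  assumes "x \<noteq> 0"
  shows "(M_inner A v x - f * M_inner M v x)\<^sup>2 \<le>
    M_inner A v v * (f * (f - lam 1) / lam 1 * M_inner M x x)"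
proof -
  define b c where "b i = M_inner M (u i) v" and "c i = M_inner M (u i) x" for i
  have pos: "0 < lam i" if "i \<in> {1..CARD('n)}" for i
    using lam_le[of 1 i] lam1_pos that by auto
  have "M_inner A v x - f * M_inner M v x = (\<Sum>i\<in>{1..CARD('n)}. (lam i - f) * (b i * c i))"
    unfolding M_inner_expansion[of v x] A_inner_expansion[of v x] b_def c_def
    by (simp add: sum_distrib_left sum_subtractf algebra_simps)
  also have "\<dots> = (\<Sum>i\<in>{1..CARD('n)}. (sqrt (lam i) * b i) * ((lam i - f) / sqrt (lam i) * c i))"
  proof (rule sum.cong)
    show "(lam i - f) * (b i * c i) = (sqrt (lam i) * b i) * ((lam i - f) / sqrt (lam i) * c i)"
      if "i \<in> {1..CARD('n)}" for i
      using pos[OF that] by (simp add: field_simps)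
  qed simp
  finally have "(M_inner A v x - f * M_inner M v x)\<^sup>2 \<le>
      (\<Sum>i\<in>{1..CARD('n)}. (sqrt (lam i) * b i)\<^sup>2) * (\<Sum>i\<in>{1..CARD('n)}. ((lam i - f) / sqrt (lam i) * c i)\<^sup>2)"
    by (simp only: Cauchy_Schwarz_ineq_sum)
  also have "(\<Sum>i\<in>{1..CARD('n)}. (sqrt (lam i) * b i)\<^sup>2) = M_inner A v v"
    unfolding A_inner_expansion[of v v] b_def[symmetric]
  proof (rule sum.cong)
    show "(sqrt (lam i) * b i)\<^sup>2 = lam i * (b i * b i)" if "i \<in> {1..CARD('n)}" for i
      using pos[OF that] by (simp add: power_mult_distrib power2_eq_square[of "b i"])
  qed simp
  also have "(\<Sum>i\<in>{1..CARD('n)}. ((lam i - f) / sqrt (lam i) * c i)\<^sup>2) \<le>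
      (\<Sum>i\<in>{1..CARD('n)}. lam i * (c i * c i) - 2 * f * (c i * c i) + f\<^sup>2 / lam 1 * (c i * c i))"
  proof (rule sum_mono)
    fix i assume i: "i \<in> {1..CARD('n)}"
    \<comment> \<open>Only the reciprocal of \<open>lam i\<close> is weakened. What remains is
      affine in \<open>lam i\<close>, so it sums to the forms of \<open>A\<close> and
      \<open>M\<close> at \<open>x\<close>.\<close>
    have "f\<^sup>2 / lam i \<le> f\<^sup>2 / lam 1"
      using lam_le[of 1 i] i lam1_pos by (intro divide_left_mono) auto
    then have "(lam i - 2 * f + f\<^sup>2 / lam i) * (c i * c i) \<le> (lam i - 2 * f + f\<^sup>2 / lam 1) * (c i * c i)"
      by (intro mult_right_mono) auto
    moreover have "((lam i - f) / sqrt (lam i) * c i)\<^sup>2 = (lam i - 2 * f + f\<^sup>2 / lam i) * (c i * c i)"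
    proof -
      have "((lam i - f) / sqrt (lam i) * c i)\<^sup>2 = (lam i - f)\<^sup>2 / lam i * (c i * c i)"
        using pos[OF i] by (simp add: power_mult_distrib power_divide power2_eq_square[of "c i"])
      also have "(lam i - f)\<^sup>2 / lam i = lam i - 2 * f + f\<^sup>2 / lam i"
        using pos[OF i] by (simp add: power2_eq_square field_simps)
      finally show ?thesis .
    qed
    ultimately show "((lam i - f) / sqrt (lam i) * c i)\<^sup>2 \<le>
        lam i * (c i * c i) - 2 * f * (c i * c i) + f\<^sup>2 / lam 1 * (c i * c i)"
      by (simp add: algebra_simps)
  qed
  also have "\<dots> = M_inner A x x - 2 * f * M_inner M x x + f\<^sup>2 / lam 1 * M_inner M x x"
    unfolding M_inner_expansion[of x x] A_inner_expansion[of x x] c_def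
    by (simp add: sum.distrib sum_subtractf sum_distrib_left)
  also have "\<dots> = f * (f - lam 1) / lam 1 * M_inner M x x"
    using M_inner_eq_Rq[OF M, of A x] lam1_pos
    by (simp add: f_def power2_eq_square divide_simps) (simp add: algebra_simps)
  finally show ?thesis
    using spd_M_inner_nonneg[OF A] by (simp add: mult_left_mono)
qed

end




section \<open>The preconditioned residual\<close>

lemma spd_matrix_inv:
  fixes T :: "real^'n^'n"
  assumes "spd T"
  shows "T *v (matrix_inv T *v x) = x"
proof -
  have "x = 0" if "T *v x = 0" for x
    using spd_M_inner_eq_0[OF assms, of x] that by (simp add: M_inner_def)
  then have "invertible T"
    unfolding invertible_left_inverse matrix_left_invertible_ker by blast
  then have "T ** matrix_inv T = mat 1"
    unfolding invertible_def matrix_inv_def by (rule someI2_ex) blast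
  then show ?thesis by (simp add: matrix_vector_mul_assoc)
qed

lemma proj_Pi_eq:
  assumes "transpose M = M"
  shows "proj_Pi M T q *v s = s - (M_inner M q s / M_inner M q (matrix_inv T *v (M *v q))) *\<^sub>R (matrix_inv T *v (M *v q))"
proof -
  define qt where "qt = matrix_inv T *v (M *v q)"
  have "(\<Sum>j\<in>UNIV. (q v* M) $ j * s $ j) = M_inner M q s"
    using dot_lmul_matrix[of q M s] by (simp add: M_inner_def inner_vec_def)
  then have "(\<chi> i j. qt $ i * (q v* M) $ j) *v s = M_inner M q s *\<^sub>R qt"
    by (simp add: vec_eq_iff matrix_vector_mult_def mult.assoc flip: sum_distrib_left)
  then show ?thesis
    by (simp add: proj_Pi_def Let_def qt_def[symmetric] matrix_vector_mult_diff_rdistrib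
        scaleR_matrix_vector_assoc[symmetric])
qed

text \<open>The projection subtracts a multiple of \<open>qt\<close>. Since
  \<open>T *v qt = M *v q\<close>, the vector \<open>qt\<close> is \<open>T\<close>-orthogonal to
  every \<open>v\<close> with \<open>M_inner M q v = 0\<close>; the correction therefore makes the
  result tangent to the hyperplane without changing its \<open>T\<close>-products with tangent
  vectors.\<close>

lemma prec_residual_properties:
  fixes A M T :: "real^'n^'n"
  assumes M: "spd M" and T: "spd T" and q: "q \<noteq> 0"
  shows "M_inner M q (prec_residual A M T q x) = 0"
    "M_inner M q v = 0 \<Longrightarrow> M_inner T (prec_residual A M T q x) v = v \<bullet> residual A M x"
proof -
  define qt where "qt = matrix_inv T *v (M *v q)"
  define s where "s = matrix_inv T *v residual A M x"
  have Msym: "transpose M = M" using M by (simp add: spd_def)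
  have Tqt: "T *v qt = M *v q" and Ts: "T *v s = residual A M x"
    by (simp_all add: qt_def s_def spd_matrix_inv[OF T])
  have "M_inner M q q \<noteq> 0" using M q by (simp add: spd_M_inner_eq_0)
  then have "M *v q \<noteq> 0" by (auto simp: M_inner_def)
  then have "qt \<noteq> 0" using Tqt by auto
  then have "0 < M_inner T qt qt" by (rule spd_M_inner_pos[OF T])
  then have pos: "0 < M_inner M q qt"
    using M_inner_commute[OF Msym, of q qt] by (simp add: M_inner_def Tqt)
  have rt: "prec_residual A M T q x = s - (M_inner M q s / M_inner M q qt) *\<^sub>R qt"
    by (simp add: prec_residual_def proj_Pi_eq[OF Msym] s_def qt_def)
  show "M_inner M q (prec_residual A M T q x) = 0"
    using pos by (simp add: rt M_inner_simps)
  assume v: "M_inner M q v = 0"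
  have "M_inner T v qt = 0"
    using v M_inner_commute[OF Msym, of q v] by (simp add: M_inner_def Tqt)
  then show "M_inner T (prec_residual A M T q x) v = v \<bullet> residual A M x"
    by (simp add: spd_M_inner_commute[OF T, of _ v] rt M_inner_simps) (simp add: M_inner_def Ts)
qed

section \<open>Completing \<open>q\<close> to an orthonormal basis\<close>

lemma prepend_column_mult:
  "prepend_column q Q *v y = y $ None *\<^sub>R q + Q *v (\<chi> k. y $ Some k)"
  by (simp add: prepend_column_def vec_eq_iff matrix_vector_mult_def UNIV_option_conv
      sum.reindex mult.commute)

context
  fixes M :: "real^'n^'n" and q :: "real^'n" and Q :: "real^'m^'n"
  assumes dim: "CARD('n) = CARD('m) + 1"
    and Q: "transpose (prepend_column q Q) ** M ** prepend_column q Q = mat 1"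
begin

lemma prepend_column_orthonormal:
  "M_inner M (prepend_column q Q *v a) (prepend_column q Q *v b) = a \<bullet> b"
  unfolding M_inner_congruence[symmetric] Q by (simp add: M_inner_def)

lemma prepend_column_surj: "surj ((*v) (prepend_column q Q))"
proof -
  let ?f = "(*v) (prepend_column q Q)"
  have lin: "linear ?f" by (rule matrix_vector_mul_linear)
  have "y = 0" if "?f y = 0" for y
    using prepend_column_orthonormal[of y y] that by (simp add: M_inner_simps)
  then have "inj ?f" using linear_injective_0[OF lin] by blast
  then have "dim (range ?f) = dim (UNIV :: (real^'m option) set)"
    by (intro dim_image_eq[OF lin]) (simp add: inj_on_def)
  then have "dim (range ?f) = DIM(real^'n)"
    using dim by (simp add: card_UNIV_option)
  then have "span (range ?f) = UNIV" by (simp only: dim_eq_full)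
  moreover have "span (range ?f) = range ?f"
    by (simp add: linear_subspace_image[OF lin] span_eq_iff[THEN iffD2])
  ultimately show ?thesis by simp
qed

text \<open>In the orthonormal coordinates given by \<open>[q, Q]\<close>, the product with
  \<open>q\<close> is the coordinate \<open>None\<close>. Thus the pencil of \<open>B\<close> and
  \<open>P\<close> is the restriction of the forms of \<open>A\<close> and \<open>T\<close> to the
  tangent space.\<close>

lemma tangent_iff_range_Q: "M_inner M q v = 0 \<longleftrightarrow> (\<exists>a. v = Q *v a)"
proof -
  obtain y where y: "v = prepend_column q Q *v y"
    using prepend_column_surj by (metis surjD)
  define e :: "real^'m option" where "e = axis None 1"
  have e: "q = prepend_column q Q *v e"
    by (simp add: prepend_column_mult e_def axis_def zero_vec_def[symmetric])
  have qv: "M_inner M q v = y $ None"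
    by (subst e, subst y, subst prepend_column_orthonormal)
      (simp add: e_def inner_axis')
  show ?thesis
  proof
    assume "M_inner M q v = 0"
    then show "\<exists>a. v = Q *v a" using y qv by (auto simp: prepend_column_mult)
  next
    assume "\<exists>a. v = Q *v a"
    then obtain a where a: "v = Q *v a" by blast
    have "Q *v a = prepend_column q Q *v (\<chi> i. case i of None \<Rightarrow> 0 | Some k \<Rightarrow> a $ k)"
      by (simp add: prepend_column_mult)
    then have "M_inner M q v = e \<bullet> (\<chi> i. case i of None \<Rightarrow> 0 | Some k \<Rightarrow> a $ k)"
      using a e prepend_column_orthonormal by metis
    then show "M_inner M q v = 0" by (simp add: e_def inner_axis')
  qed
qed

lemma Q_injective:
  assumes "Q *v a = 0"
  shows "a = 0"
proof -
  define y :: "real^'m option" where "y = (\<chi> i. case i of None \<Rightarrow> 0 | Some k \<Rightarrow> a $ k)"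
  have "prepend_column q Q *v y = 0"
    using assms by (simp add: prepend_column_mult y_def)
  then have "y \<bullet> y = 0"
    using prepend_column_orthonormal[of y y] by (simp add: M_inner_simps)
  then have "y $ Some k = 0" for k by simp
  then show ?thesis by (simp add: y_def vec_eq_iff)
qed

lemma spd_compression:
  assumes S: "spd S"
  shows "spd (transpose Q ** S ** Q)"
  unfolding spd_def
proof
  show "transpose (transpose Q ** S ** Q) = transpose Q ** S ** Q"
    using S by (simp add: spd_def matrix_transpose_mul matrix_mul_assoc)
  show "\<forall>a. a \<noteq> 0 \<longrightarrow> 0 < a \<bullet> ((transpose Q ** S ** Q) *v a)"
    using Q_injective spd_M_inner_pos[OF S] by (metis M_inner_congruence M_inner_def)
qed

end

section \<open>Convexity and smoothness in the affine chart\<close>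

text \<open>The matrix \<open>Q\<close> is represented here by \<open>xi_bounds\<close>, the
  comparison of \<open>A\<close> with \<open>T\<close> on the tangent space of the
  hyperplane.\<close>

locale epic_chart = spd_pencil A M lam u
  for A M :: "real^'n^'n" and lam u +
  fixes T :: "real^'n^'n" and q :: "real^'n" and \<rho> \<xi>min \<xi>max chi \<mu> L :: real
  assumes T: "spd T"
    and q_norm: "M_inner M q q = 1" and q_u1: "0 < M_inner M q (u 1)"
    and xi_pos: "0 < \<xi>min" and xi_le: "\<xi>min \<le> \<xi>max"
    and xi_bounds: "\<And>v. M_inner M q v = 0 \<Longrightarrow>
      \<xi>min * M_inner T v v \<le> M_inner A v v \<and> M_inner A v v \<le> \<xi>max * M_inner T v v"
    and rho: "\<rho> = Rq A M q"
    and chi: "chi = chi_P (lam 1) (lam 2) \<xi>min \<xi>max"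
    and mu: "\<mu> = mu_P (lam 1) (lam 2) \<xi>min \<xi>max \<rho>"
    and L: "L = L_P (lam 1) (lam 2) (lam CARD('n)) \<xi>min \<xi>max \<rho>"
    and rho_less: "\<rho> < lam 1 + (lam 2 - lam 1) / (2 + chi)"
begin

definition \<delta> :: real where "\<delta> = \<rho> - lam 1"
text \<open>Bounds the squared sine of the \<open>M\<close>-angle between \<open>u 1\<close> and any
  vector whose Rayleigh quotient is at most \<open>\<rho>\<close>; see
  \<open>u1_component\<close>.\<close>

definition \<sigma> :: real where "\<sigma> = \<delta> / (lam 2 - lam 1)"
definition W :: "(real^'n) set" where "W = {x. M_inner M q x = 1 \<and> Rq A M x \<le> \<rho>}"
text \<open>The size of the mixed term of the Hessian relative to the \<open>A\<close>-form of the
  direction.\<close>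

definition k\<^sub>0 :: real where "k\<^sub>0 = 8 * \<delta> / lam 1 * sqrt ((lam 2 + lam 1) / (2 * (lam 2 - lam 1)))"
text \<open>The fraction of the \<open>A\<close>-form of a tangent direction that survives in the
  numerator of the Hessian.\<close>

definition m\<^sub>0 :: real where "m\<^sub>0 = 1 - lam 1 / lam 2 - (2 + chi) / lam 2 * \<delta>"

lemma q_nonzero: "q \<noteq> 0"
  using q_norm by (auto simp: M_inner_simps)

lemma delta_nonneg: "0 \<le> \<delta>"
  using Rq_ge_lam1[OF q_nonzero] by (simp add: \<delta>_def flip: rho)

lemma chi_eq: "chi = 8 * lam 2 / lam 1 * (\<xi>max / \<xi>min) * sqrt ((lam 2 + lam 1) / (2 * (lam 2 - lam 1)))"
  by (simp add: chi chi_P_def)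

text \<open>This turns the hypothesis on \<open>\<rho>\<close> into
  \<open>6 * \<delta> < lam 2 - lam 1\<close>, and hence \<open>4 * \<sigma> < 1\<close>.\<close>

lemma chi_ge_4: "4 \<le> chi"
proof -
  \<comment> \<open>The fraction even exceeds 1/2, but 1/4 has a rational square root.\<close>
  have "1/4 \<le> (lam 2 + lam 1) / (2 * (lam 2 - lam 1))"
    using lam12 lam1_pos by (simp add: field_simps)
  then have "sqrt (1/4) \<le> sqrt ((lam 2 + lam 1) / (2 * (lam 2 - lam 1)))"
    by (rule real_sqrt_le_mono)
  then have s: "1/2 \<le> sqrt ((lam 2 + lam 1) / (2 * (lam 2 - lam 1)))"
    by (simp add: real_sqrt_divide)
  have "1 \<le> lam 2 / lam 1" using lam12 lam1_pos by simp
  moreover have "1 \<le> \<xi>max / \<xi>min" using xi_pos xi_le by simp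
  ultimately have "1 * 1 \<le> lam 2 / lam 1 * (\<xi>max / \<xi>min)" by (intro mult_mono) auto
  then have "8 * 1 * (1/2) \<le> 8 * (lam 2 / lam 1 * (\<xi>max / \<xi>min)) * sqrt ((lam 2 + lam 1) / (2 * (lam 2 - lam 1)))"
    using s by (intro mult_mono) auto
  then show ?thesis by (simp add: chi_eq)
qed

lemma delta_chi: "(2 + chi) * \<delta> < lam 2 - lam 1"
  using rho_less chi_ge_4 by (simp add: \<delta>_def field_simps)

lemma delta_small: "6 * \<delta> < lam 2 - lam 1"
proof -
  have "6 * \<delta> \<le> (2 + chi) * \<delta>" using chi_ge_4 delta_nonneg by (intro mult_right_mono) auto
  then show ?thesis using delta_chi by linarith
qed

lemma sigma_bounds: "0 \<le> \<sigma>" "4 * \<sigma> < 1" "\<sigma> * (lam 2 - lam 1) = \<delta>"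
  using delta_small delta_nonneg lam12 by (auto simp: \<sigma>_def field_simps)

lemma k0_eq: "k\<^sub>0 = chi / lam 2 * (\<xi>min / \<xi>max) * \<delta>"
  using lam1_pos lam12 xi_pos xi_le by (simp add: k\<^sub>0_def chi_eq)

lemma k0_nonneg: "0 \<le> k\<^sub>0"
  unfolding k0_eq using chi_ge_4 delta_nonneg lam1_pos lam12 xi_pos xi_le by auto

lemma k0_le: "k\<^sub>0 \<le> chi / lam 2 * \<delta>"
proof -
  have "chi / lam 2 * \<delta> * (\<xi>min / \<xi>max) \<le> chi / lam 2 * \<delta> * 1"
    using chi_ge_4 delta_nonneg lam1_pos lam12 xi_pos xi_le by (intro mult_left_mono) auto
  then show ?thesis by (simp add: k0_eq algebra_simps)
qed

lemma m0_pos: "0 < m\<^sub>0"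
proof -
  have "m\<^sub>0 = (lam 2 - lam 1 - (2 + chi) * \<delta>) / lam 2"
    using lam1_pos lam12 by (simp add: m\<^sub>0_def diff_divide_distrib)
  then show ?thesis using delta_chi lam1_pos lam12 by simp
qed

lemma mu_eq: "\<mu> = 2 * \<xi>min * (1 - 4 * \<sigma>) * m\<^sub>0"
  by (simp add: mu mu_P_def \<sigma>_def \<delta>_def m\<^sub>0_def flip: chi)

lemma L_eq: "L = 2 * \<xi>max * (1 - lam 1 / lam CARD('n) + k\<^sub>0)"
  by (simp add: L L_P_def k0_eq \<delta>_def flip: chi)

lemma mu_pos: "0 < \<mu>"
  using mu_eq xi_pos sigma_bounds m0_pos by simp

lemma mu_le_L: "\<mu> \<le> L"
proof -
  have "m\<^sub>0 \<le> 1 - lam 1 / lam 2"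
    using chi_ge_4 delta_nonneg lam1_pos lam12 by (simp add: m\<^sub>0_def)
  also have "\<dots> \<le> 1 - lam 1 / lam CARD('n)"
    using lam2_le_lamn lam1_pos lam12 by (simp add: frac_le)
  finally have m: "m\<^sub>0 \<le> 1 - lam 1 / lam CARD('n) + k\<^sub>0" using k0_nonneg by linarith
  have "2 * \<xi>min * (1 - 4 * \<sigma>) \<le> 2 * \<xi>min * 1"
    using xi_pos sigma_bounds by (intro mult_left_mono) auto
  also have "\<dots> \<le> 2 * \<xi>max" using xi_le by simp
  finally have "2 * \<xi>min * (1 - 4 * \<sigma>) \<le> 2 * \<xi>max" .
  then show ?thesis
    unfolding mu_eq L_eq by (rule mult_mono[OF _ m]) (use m0_pos xi_pos xi_le in auto)
qed

lemma W_nonzero: "x \<in> W \<Longrightarrow> x \<noteq> 0"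
  by (auto simp: W_def M_inner_simps)

lemma W_A_le: "x \<in> W \<Longrightarrow> M_inner A x x \<le> \<rho> * M_inner M x x"
  using Rq_le_iff[OF M W_nonzero, of x A \<rho>] by (simp add: W_def)

lemma q_in_W: "q \<in> W"
  by (simp add: W_def q_norm flip: rho)

section \<open>Angles with \<open>u 1\<close> and norms in the chart\<close>

lemma u1_component:
  assumes "M_inner A x x \<le> \<rho> * M_inner M x x"
  shows "(1 - \<sigma>) * M_inner M x x \<le> (M_inner M (u 1) x)\<^sup>2"
proof -
  have "(lam 2 - lam 1) * ((1 - \<sigma>) * M_inner M x x) =
      lam 2 * M_inner M x x - lam 1 * M_inner M x x - \<sigma> * (lam 2 - lam 1) * M_inner M x x"
    by (simp add: algebra_simps)
  also have "\<dots> \<le> (lam 2 - lam 1) * (M_inner M (u 1) x)\<^sup>2"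
    unfolding sigma_bounds(3) using A_ge_lam2[of x] assms by (simp add: \<delta>_def algebra_simps)
  finally show ?thesis using lam12 by simp
qed

lemma M_u1_u1: "M_inner M (u 1) (u 1) = 1"
  using M_u_u[of 1 1] card_ge_2 by simp

lemma u1_q: "1 - \<sigma> \<le> (M_inner M (u 1) q)\<^sup>2" "0 < M_inner M (u 1) q"
  using u1_component[OF W_A_le[OF q_in_W]] q_u1 by (simp_all add: q_norm Mc[of q "u 1"])

text \<open>Both \<open>x\<close> and \<open>q\<close> form a small angle with the line of
  \<open>u 1\<close>, hence with each other up to sign. Since their product is 1 and
  \<open>q\<close> is a unit vector, the norm of \<open>x\<close> is close to 1, and the sign of its
  \<open>u 1\<close>-component is determined.\<close>

lemma chart_norm:
  assumes "x \<in> W"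
  shows "1 \<le> M_inner M x x" "(1 - 4 * \<sigma>) * M_inner M x x \<le> 1" "0 < M_inner M (u 1) x"
proof -
  define a c D where "a = M_inner M (u 1) x" and "c = M_inner M (u 1) q" and "D = M_inner M x x"
  have qx: "M_inner M q x = 1" "M_inner M x q = 1" using assms Mc[of x q] by (auto simp: W_def)
  show D1: "1 \<le> M_inner M x x"
    using spd_Cauchy_Schwarz[OF M, of q x] by (simp add: qx q_norm)
  have a2: "(1 - \<sigma>) * D \<le> a\<^sup>2"
    using u1_component[OF W_A_le[OF assms]] by (simp add: a_def D_def)
  have c2: "1 - \<sigma> \<le> c\<^sup>2" and c: "0 < c" using u1_q by (auto simp: c_def)
  \<comment> \<open>Removing the \<open>u 1\<close>-components leaves vectors with product
    \<open>1 - a * c\<close> and squared norms at most \<open>\<sigma> * D\<close> and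
    \<open>\<sigma>\<close>.\<close>
  have "(M_inner M (x - a *\<^sub>R u 1) (q - c *\<^sub>R u 1))\<^sup>2 \<le>
     M_inner M (x - a *\<^sub>R u 1) (x - a *\<^sub>R u 1) * M_inner M (q - c *\<^sub>R u 1) (q - c *\<^sub>R u 1)"
    by (rule spd_Cauchy_Schwarz[OF M])
  then have "(1 - a * c)\<^sup>2 \<le> (D - a\<^sup>2) * (1 - c\<^sup>2)"
    by (simp add: M_inner_simps qx q_norm M_u1_u1 Mc[of x "u 1"] Mc[of q "u 1"] a_def[symmetric]
        c_def[symmetric] D_def[symmetric] power2_eq_square algebra_simps)
  also have "\<dots> \<le> (\<sigma> * D) * \<sigma>"
    using a2 c2 sigma_bounds D1
      spd_Cauchy_Schwarz[OF M, of "u 1" q]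
    by (intro mult_mono) (auto simp: algebra_simps M_u1_u1 q_norm c_def D_def)
  also have "\<dots> = (\<sigma> * sqrt D)\<^sup>2"
    using D1 by (simp add: D_def power_mult_distrib power2_eq_square)
  finally have gram: "\<bar>1 - a * c\<bar> \<le> \<sigma> * sqrt D"
    using sigma_bounds D1 by (simp add: D_def power2_le_iff_abs_le)
  have "((1 - \<sigma>) * sqrt D)\<^sup>2 = ((1 - \<sigma>) * D) * (1 - \<sigma>)"
    using D1 by (simp add: D_def power_mult_distrib power2_eq_square)
  also have "\<dots> \<le> a\<^sup>2 * c\<^sup>2"
    using a2 c2 sigma_bounds D1 by (intro mult_mono) (auto simp: D_def)
  finally have "((1 - \<sigma>) * sqrt D)\<^sup>2 \<le> (a * c)\<^sup>2"
    by (simp add: power_mult_distrib)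
  then have "\<bar>(1 - \<sigma>) * sqrt D\<bar> \<le> \<bar>a * c\<bar>"
    by (simp only: abs_le_square_iff)
  then have ac_abs: "sqrt D - \<sigma> * sqrt D \<le> \<bar>a * c\<bar>"
    by (simp only: left_diff_distrib mult_1 abs_le_iff)
  have sD: "1 \<le> sqrt D" using D1 by (simp add: D_def)
  have e: "4 * (\<sigma> * sqrt D) \<le> sqrt D"
    using mult_right_mono[of "4 * \<sigma>" 1 "sqrt D"] sigma_bounds sD by simp
  \<comment> \<open>Here \<open>p\<close>, \<open>r\<close>, \<open>e\<close> stand for
    \<open>a * c\<close>, \<open>sqrt D\<close> and \<open>\<sigma> * sqrt D\<close>. A nonpositive
    \<open>p\<close> would give \<open>r \<le> 2 * e - 1\<close>, contradicting
    \<open>4 * e \<le> r\<close> and \<open>1 \<le> r\<close>.\<close>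
  have "0 < p \<and> r - 2 * e \<le> 1"
    if "\<bar>1 - p\<bar> \<le> e" "r - e \<le> \<bar>p\<bar>" "1 \<le> r" "4 * e \<le> r" for p r e :: real
    using that by linarith
  from this[OF gram ac_abs sD e] have ac: "0 < a * c" "(1 - 2 * \<sigma>) * sqrt D \<le> 1"
    by (simp_all only: left_diff_distrib mult_1 mult.assoc)
  show "0 < M_inner M (u 1) x"
    using ac(1) c by (simp add: a_def zero_less_mult_iff)
  have "(1 - 4 * \<sigma>) * D \<le> (1 - 2 * \<sigma>)\<^sup>2 * D"
    using D1 by (intro mult_right_mono) (auto simp: D_def power2_eq_square algebra_simps)
  also have "\<dots> = ((1 - 2 * \<sigma>) * sqrt D)\<^sup>2"
    using D1 by (simp add: power_mult_distrib D_def)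
  also have "\<dots> \<le> 1"
    using ac(2) sigma_bounds sD by (intro power_le_one) auto
  finally show "(1 - 4 * \<sigma>) * M_inner M x x \<le> 1" by (simp add: D_def)
qed

text \<open>A tangent vector is \<open>M\<close>-orthogonal to \<open>q\<close>, so it meets only
  the part of \<open>u 1\<close> orthogonal to \<open>q\<close>. That part has squared norm at most
  \<open>\<sigma>\<close>, which costs \<open>\<delta>\<close> in \<open>A_ge_lam2\<close>.\<close>

lemma tangent_bound:
  assumes v: "M_inner M q v = 0"
  shows "(lam 2 - \<delta>) * M_inner M v v \<le> M_inner A v v"
proof -
  define c where "c = M_inner M (u 1) q"
  have "(M_inner M (u 1 - c *\<^sub>R q) v)\<^sup>2 \<le>
      M_inner M (u 1 - c *\<^sub>R q) (u 1 - c *\<^sub>R q) * M_inner M v v"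
    by (rule spd_Cauchy_Schwarz[OF M])
  then have "(M_inner M (u 1) v)\<^sup>2 \<le> (1 - c\<^sup>2) * M_inner M v v"
    by (simp add: M_inner_simps v M_u1_u1 q_norm Mc[of q "u 1"] c_def power2_eq_square)
  also have "\<dots> \<le> \<sigma> * M_inner M v v"
    using u1_q(1) spd_M_inner_nonneg[OF M] by (intro mult_right_mono) (auto simp: c_def)
  finally have "(lam 2 - lam 1) * (M_inner M (u 1) v)\<^sup>2 \<le> (lam 2 - lam 1) * (\<sigma> * M_inner M v v)"
    using lam12 by (intro mult_left_mono) auto
  also have "\<dots> = \<sigma> * (lam 2 - lam 1) * M_inner M v v"
    by simp
  also have "\<dots> = \<delta> * M_inner M v v"
    by (simp only: sigma_bounds(3))
  finally show ?thesis using A_ge_lam2[of v] by (simp add: algebra_simps)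
qed

text \<open>\<open>W\<close> is a slice of one nappe of the Lorentz cone of \<open>A - \<rho> M\<close>: eliminating the
  \<open>u 1\<close>-component between two of its points leaves a vector on which that form is nonnegative.\<close>

lemma W_convex:
  assumes x: "x \<in> W" and y: "y \<in> W" and t: "0 \<le> t" "t \<le> 1"
  shows "x + t *\<^sub>R (y - x) \<in> W"
proof -
  define S where "S v w = M_inner A v w - \<rho> * M_inner M v w" for v w
  define s where "s = M_inner M (u 1) x / M_inner M (u 1) y"
  have s: "0 < s" using chart_norm(3)[OF x] chart_norm(3)[OF y] by (simp add: s_def)
  have Sx: "S x x \<le> 0" "S y y \<le> 0" using W_A_le x y by (auto simp: S_def)
  define w where "w = x - s *\<^sub>R y"
  have "M_inner M (u 1) w = 0"
    using chart_norm(3)[OF y] by (simp add: w_def M_inner_simps s_def)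
  then have "lam 2 * M_inner M w w \<le> M_inner A w w" using A_ge_lam2[of w] by simp
  moreover have "\<rho> * M_inner M w w \<le> lam 2 * M_inner M w w"
    using delta_small delta_nonneg spd_M_inner_nonneg[OF M] by (intro mult_right_mono) (auto simp: \<delta>_def)
  ultimately have "0 \<le> S w w" by (simp add: S_def)
  also have "S w w = S x x - 2 * s * S x y + s\<^sup>2 * S y y"
    by (simp add: S_def w_def M_inner_simps Mc[of y x] Ac[of y x] power2_eq_square algebra_simps)
  also have "\<dots> \<le> 0 - 2 * s * S x y + 0"
    using Sx by (intro add_mono diff_mono) (auto simp: mult_nonneg_nonpos)
  finally have Sxy: "S x y \<le> 0" using s by (simp add: mult_le_0_iff)
  let ?z = "x + t *\<^sub>R (y - x)"
  have "S ?z ?z = (1 - t)\<^sup>2 * S x x + 2 * (t * (1 - t)) * S x y + t\<^sup>2 * S y y"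
    by (simp add: S_def M_inner_simps Mc[of y x] Ac[of y x] power2_eq_square algebra_simps)
  also have "\<dots> \<le> 0"
    using Sx Sxy t by (intro add_nonpos_nonpos mult_nonneg_nonpos) auto
  finally have "M_inner A ?z ?z \<le> \<rho> * M_inner M ?z ?z" by (simp add: S_def)
  moreover have z1: "M_inner M q ?z = 1"
    using x y by (simp add: W_def M_inner_simps)
  moreover have "w \<noteq> 0" if "M_inner M q w = 1" for w
    using that by (auto simp: M_inner_simps)
  ultimately show ?thesis unfolding W_def using Rq_le_iff[OF M] by blast
qed

text \<open>The term is a product of two small quantities: the residual tested against
  \<open>v\<close>, of squared order \<open>\<delta>\<close>, and the \<open>M\<close>-product of
  \<open>v\<close> with \<open>x\<close>, of squared order \<open>\<sigma>\<close>.\<close>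

lemma hessian_mixed_term:
  assumes x: "x \<in> W" and v: "M_inner M q v = 0"
  shows "\<bar>2 * dRq A M x v * M_inner M v x\<bar> \<le> k\<^sub>0 * M_inner A v v"
proof -
  define F G D f where "F = M_inner A v v" and "G = M_inner M v v" and "D = M_inner M x x"
    and "f = Rq A M x"
  define \<beta> \<gamma> where "\<beta> = M_inner A v x - f * M_inner M v x" and "\<gamma> = M_inner M v x"
  have D: "1 \<le> D" "(1 - 4 * \<sigma>) * D \<le> 1" using chart_norm[OF x] by (auto simp: D_def)
  have G: "0 \<le> G" "(lam 2 - \<delta>) * G \<le> F"
    using tangent_bound[OF v] spd_M_inner_nonneg[OF M] by (auto simp: F_def G_def)
  have F: "0 \<le> F" using spd_M_inner_nonneg[OF A] by (simp add: F_def)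
  have f: "lam 1 \<le> f" "f \<le> \<rho>" using x Rq_ge_lam1[OF W_nonzero] by (auto simp: f_def W_def)
  have "f * (f - lam 1) / lam 1 \<le> \<rho> * \<delta> / lam 1"
    using f lam1_pos by (intro divide_right_mono mult_mono) (auto simp: \<delta>_def)
  moreover have "\<beta>\<^sup>2 \<le> F * (f * (f - lam 1) / lam 1 * D)"
    using residual_bound[OF W_nonzero[OF x], of v] by (simp add: \<beta>_def F_def f_def D_def)
  ultimately have \<beta>: "\<beta>\<^sup>2 \<le> F * (\<rho> * \<delta> / lam 1 * D)"
    using F D by (meson mult_left_mono mult_right_mono order_trans zero_le_one)
  have qx: "M_inner M q x = 1" "M_inner M x q = 1" using x Mc[of x q] by (auto simp: W_def)
  \<comment> \<open>Because \<open>v\<close> is orthogonal to \<open>q\<close>, the point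
    \<open>x\<close> may be replaced by \<open>x - q\<close>, whose squared norm
    \<open>D - 1\<close> is at most \<open>4 * \<sigma> * D\<close>.\<close>
  have "(M_inner M (x - q) v)\<^sup>2 \<le> M_inner M (x - q) (x - q) * G"
    unfolding G_def by (rule spd_Cauchy_Schwarz[OF M])
  then have "\<gamma>\<^sup>2 \<le> (D - 1) * G"
    by (simp add: M_inner_simps v qx q_norm \<gamma>_def D_def Mc[of x v])
  also have "\<dots> \<le> 4 * \<sigma> * D * G"
    using D G by (intro mult_right_mono) (auto simp: algebra_simps)
  finally have \<gamma>: "\<gamma>\<^sup>2 \<le> 4 * \<sigma> * D * G" .
  have \<rho>G: "\<rho> * G \<le> F"
  proof -
    have "\<rho> * G \<le> (lam 2 - \<delta>) * G"
      using delta_small delta_nonneg G by (intro mult_right_mono) (auto simp: \<delta>_def)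
    then show ?thesis using G by linarith
  qed
  have "(4 * \<beta> * \<gamma> / D)\<^sup>2 = 16 * (\<beta>\<^sup>2 * \<gamma>\<^sup>2) / D\<^sup>2"
    by (simp add: power_mult_distrib power_divide)
  also have "\<dots> \<le> 16 * (F * (\<rho> * \<delta> / lam 1 * D) * (4 * \<sigma> * D * G)) / D\<^sup>2"
    using \<beta> \<gamma> F D f delta_nonneg lam1_pos
    by (intro divide_right_mono mult_left_mono mult_mono) auto
  also have "\<dots> = 64 * \<delta> * \<sigma> / lam 1 * F * (\<rho> * G)"
    using D by (simp add: power2_eq_square)
  also have "\<dots> \<le> 64 * \<delta> * \<sigma> / lam 1 * F * F"
    using \<rho>G F delta_nonneg sigma_bounds lam1_pos by (intro mult_left_mono) auto
  also have "64 * \<delta> * \<sigma> / lam 1 * F * F \<le> k\<^sub>0\<^sup>2 * F\<^sup>2"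
  proof -
    have "k\<^sub>0\<^sup>2 = (8 * \<delta> / lam 1)\<^sup>2 * (sqrt ((lam 2 + lam 1) / (2 * (lam 2 - lam 1))))\<^sup>2"
      unfolding k\<^sub>0_def by (rule power_mult_distrib)
    also have "\<dots> = (8 * \<delta> / lam 1)\<^sup>2 * ((lam 2 + lam 1) / (2 * (lam 2 - lam 1)))"
      using lam1_pos lam12 by (subst real_sqrt_pow2) auto
    also have "\<dots> = 64 * \<delta> * \<sigma> / lam 1 * ((lam 2 + lam 1) / (2 * lam 1))"
    proof -
      have eq: "(8 * d / l)\<^sup>2 * (s / (2 * e)) = 64 * d * (d / e) / l * (s / (2 * l))"
        if "0 < l" "0 < e" for d l s e :: real
        using that by (simp add: power2_eq_square field_simps)
      show ?thesis
        unfolding \<sigma>_def by (rule eq) (use lam1_pos lam12 in auto)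
    qed
    \<comment> \<open>The factor dropped, \<open>(lam 2 + lam 1) / (2 * lam 1)\<close>, is at least
      1.\<close>
    also have "\<dots> \<ge> 64 * \<delta> * \<sigma> / lam 1 * 1"
      using delta_nonneg sigma_bounds lam1_pos lam12 by (intro mult_left_mono) auto
    finally have "64 * \<delta> * \<sigma> / lam 1 * 1 * (F * F) \<le> k\<^sub>0\<^sup>2 * (F * F)"
      using F by (intro mult_right_mono) auto
    then show ?thesis by (simp add: power2_eq_square[of F] algebra_simps)
  qed
  finally have "(4 * \<beta> * \<gamma> / D)\<^sup>2 \<le> (k\<^sub>0 * F)\<^sup>2"
    by (simp add: power_mult_distrib)
  then have "\<bar>4 * \<beta> * \<gamma> / D\<bar> \<le> k\<^sub>0 * F"
    using k0_nonneg F by (simp add: power2_le_iff_abs_le)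
  then show ?thesis
    by (simp add: dRq_def \<beta>_def \<gamma>_def f_def D_def F_def)
qed

text \<open>Each factor of \<open>\<mu>\<close> and \<open>L\<close> has one source: the comparison
  of \<open>A\<close> with \<open>T\<close> gives \<open>\<xi>min\<close> and
  \<open>\<xi>max\<close>, the norm \<open>D\<close> gives \<open>1 - 4 * \<sigma>\<close>, and the
  numerator \<open>F - f * G - h\<close> gives the rest.\<close>

lemma hessian_bounds:
  assumes x: "x \<in> W" and v: "M_inner M q v = 0"
  shows "\<mu> * M_inner T v v \<le> d2Rq A M x v" "d2Rq A M x v \<le> L * M_inner T v v"
proof -
  define F G D f h where "F = M_inner A v v" and "G = M_inner M v v" and "D = M_inner M x x"
    and "f = Rq A M x" and "h = 2 * dRq A M x v * M_inner M v x"
  have h: "\<bar>h\<bar> \<le> k\<^sub>0 * F" using hessian_mixed_term[OF x v] by (simp add: h_def F_def)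
  have D: "1 \<le> D" "(1 - 4 * \<sigma>) * D \<le> 1" using chart_norm[OF x] by (auto simp: D_def)
  have G: "0 \<le> G" "(lam 2 - \<delta>) * G \<le> F" "F \<le> lam CARD('n) * G"
    using tangent_bound[OF v] spd_M_inner_nonneg[OF M] A_le_lamn by (auto simp: F_def G_def)
  have F: "0 \<le> F" using spd_M_inner_nonneg[OF A] by (simp add: F_def)
  have f: "lam 1 \<le> f" "f \<le> \<rho>" using x Rq_ge_lam1[OF W_nonzero] by (auto simp: f_def W_def)
  have d2: "d2Rq A M x v = 2 * (F - f * G - h) / D"
    by (simp add: d2Rq_def F_def G_def D_def f_def h_def)
  have TF: "\<xi>min * M_inner T v v \<le> F" "F \<le> \<xi>max * M_inner T v v"
    using xi_bounds[OF v] by (auto simp: F_def)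
  have "lam 2 * (f * G) \<le> (lam 1 + 2 * \<delta>) * F"
  proof -
    \<comment> \<open>This is the origin of the 2 in \<open>2 + chi\<close>: trading
      \<open>G\<close> for \<open>F\<close> through \<open>tangent_bound\<close> raises
      \<open>lam 1 + \<delta>\<close> over \<open>lam 2 - \<delta>\<close> to at most
      \<open>lam 1 + 2 * \<delta>\<close> over \<open>lam 2\<close>.\<close>
    have "lam 2 * \<rho> \<le> (lam 1 + 2 * \<delta>) * (lam 2 - \<delta>)"
    proof -
      have "(lam 1 + 2 * \<delta>) * (lam 2 - \<delta>) - lam 2 * \<rho> = \<delta> * (lam 2 - lam 1 - 2 * \<delta>)"
        by (simp add: \<delta>_def algebra_simps)
      also have "\<dots> \<ge> 0" using delta_nonneg delta_small by simp
      finally show ?thesis by simp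
    qed
    moreover have "lam 2 * f \<le> lam 2 * \<rho>" using f lam1_pos lam12 by simp
    ultimately have "lam 2 * f * G \<le> (lam 1 + 2 * \<delta>) * (lam 2 - \<delta>) * G"
      using G by (intro mult_right_mono) auto
    also have "\<dots> \<le> (lam 1 + 2 * \<delta>) * F"
      using G delta_nonneg lam1_pos unfolding mult.assoc by (intro mult_left_mono) auto
    finally show ?thesis by (simp add: mult.assoc)
  qed
  then have "f * G \<le> (lam 1 / lam 2 + 2 * \<delta> / lam 2) * F"
    using lam1_pos lam12 by (simp add: field_simps)
  moreover have "k\<^sub>0 * F \<le> chi / lam 2 * \<delta> * F"
    using k0_le F by (rule mult_right_mono)
  ultimately have low: "m\<^sub>0 * F \<le> F - f * G - h"
    using h by (simp add: m\<^sub>0_def algebra_simps add_divide_distrib)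
  have "\<mu> * M_inner T v v \<le> 2 * (1 - 4 * \<sigma>) * m\<^sub>0 * F"
    unfolding mu_eq using mult_left_mono[OF TF(1), of "2 * (1 - 4 * \<sigma>) * m\<^sub>0"] sigma_bounds m0_pos
    by (simp add: algebra_simps)
  also have "\<dots> * D \<le> 2 * m\<^sub>0 * F"
    using mult_left_mono[OF D(2), of "2 * m\<^sub>0 * F"] m0_pos F by (simp add: algebra_simps)
  then have "2 * (1 - 4 * \<sigma>) * m\<^sub>0 * F \<le> d2Rq A M x v"
    unfolding d2 using low D by (simp add: le_divide_eq)
  finally show "\<mu> * M_inner T v v \<le> d2Rq A M x v" .
  have "lam 1 / lam CARD('n) * F \<le> lam 1 * G"
    using mult_left_mono[OF G(3), of "lam 1 / lam CARD('n)"] lam1_pos lam12 lam2_le_lamn by simp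
  also have "\<dots> \<le> f * G" using f G by (intro mult_right_mono) auto
  finally have up: "F - f * G - h \<le> (1 - lam 1 / lam CARD('n) + k\<^sub>0) * F"
    using h by (simp add: algebra_simps)
  \<comment> \<open>Nonnegativity of the numerator allows the division by \<open>D\<close>, which is
    at least 1, to be dropped in the upper bound.\<close>
  have "0 \<le> F - f * G - h" using low m0_pos F by (meson mult_nonneg_nonneg order_trans less_imp_le)
  then have "d2Rq A M x v \<le> 2 * (F - f * G - h)"
    unfolding d2 using D by (simp add: divide_le_eq mult_le_cancel_left1)
  also have "\<dots> \<le> 2 * (1 - lam 1 / lam CARD('n) + k\<^sub>0) * F"
    using mult_left_mono[OF up, of 2] by (simp only: mult.assoc)
  also have "\<dots> \<le> L * M_inner T v v"
  proof -
    have "lam 1 / lam CARD('n) \<le> 1"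
      using lam1_pos lam12 lam2_le_lamn by simp
    then have c: "0 \<le> 2 * (1 - lam 1 / lam CARD('n) + k\<^sub>0)"
      using k0_nonneg by simp
    show ?thesis
      unfolding L_eq using mult_left_mono[OF TF(2) c] by (simp only: ac_simps)
  qed
  finally show "d2Rq A M x v \<le> L * M_inner T v v" .
qed

section \<open>Accelerated descent\<close>

lemma L_pos: "0 < L"
  using mu_pos mu_le_L by linarith

lemma chart_nonzero: "M_inner M q w = 1 \<Longrightarrow> w \<noteq> 0"
  by (auto simp: M_inner_simps)

lemma W_difference: "x \<in> W \<Longrightarrow> y \<in> W \<Longrightarrow> M_inner M q (y - x) = 0"
  by (simp add: W_def M_inner_simps)

text \<open>Convexity of \<open>W\<close> keeps the segment away from zero, where the quotient is
  not differentiable, and places the intermediate point where the Hessian bounds hold.\<close>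

lemma W_Taylor:
  assumes x: "x \<in> W" and y: "y \<in> W"
  obtains z where "z \<in> W" "Rq A M y = Rq A M x + dRq A M x (y - x) + d2Rq A M z (y - x) / 2"
proof -
  define d where "d = y - x"
  \<comment> \<open>The family of derivatives indexed by order, as \<open>Maclaurin\<close> expects;
    its last branch serves order 2.\<close>
  define \<phi> where "\<phi> m t = (if m = 0 then Rq A M (x + t *\<^sub>R d)
    else if m = 1 then dRq A M (x + t *\<^sub>R d) d else d2Rq A M (x + t *\<^sub>R d) d)" for m :: nat and t
  have W: "x + t *\<^sub>R d \<in> W" if "0 \<le> t" "t \<le> 1" for t
    unfolding d_def by (rule W_convex[OF x y that])
  have "\<exists>t::real. 0 < t \<and> t < 1 \<and> \<phi> 0 1 = (\<Sum>m<2. \<phi> m 0 / fact m * 1 ^ m) + \<phi> 2 t / fact 2 * 1 ^ 2"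
  proof (rule Maclaurin)
    show "\<forall>m t. m < 2 \<and> 0 \<le> t \<and> t \<le> 1 \<longrightarrow> (\<phi> m has_real_derivative \<phi> (Suc m) t) (at t)"
    proof (intro allI impI)
      fix m :: nat and t :: real assume a: "m < 2 \<and> 0 \<le> t \<and> t \<le> 1"
      then have nz: "x + t *\<^sub>R d \<noteq> 0" using W W_nonzero by blast
      have "m = 0 \<or> m = 1" using a by auto
      then show "(\<phi> m has_real_derivative \<phi> (Suc m) t) (at t)"
        using has_derivative_Rq_line[OF Asym M nz] has_derivative_dRq_line[OF Asym M nz]
        by (auto simp: \<phi>_def[abs_def])
    qed
  qed auto
  then obtain t where t: "0 < t" "t < 1" "Rq A M y = Rq A M x + dRq A M x d + d2Rq A M (x + t *\<^sub>R d) d / 2"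
    by (auto simp: \<phi>_def d_def numeral_2_eq_2 fact_numeral One_nat_def)
  show ?thesis
    using that[OF W[of t]] t by (simp add: d_def)
qed

lemma W_strongly_convex:
  assumes "x \<in> W" "y \<in> W"
  shows "Rq A M x + dRq A M x (y - x) + \<mu> / 2 * M_inner T (y - x) (y - x) \<le> Rq A M y"
proof -
  obtain z where "z \<in> W" "Rq A M y = Rq A M x + dRq A M x (y - x) + d2Rq A M z (y - x) / 2"
    using W_Taylor[OF assms] .
  then show ?thesis using hessian_bounds(1)[OF _ W_difference[OF assms], of z] by simp
qed

lemma W_smooth:
  assumes "x \<in> W" "y \<in> W"
  shows "Rq A M y \<le> Rq A M x + dRq A M x (y - x) + L / 2 * M_inner T (y - x) (y - x)"
proof -
  obtain z where "z \<in> W" "Rq A M y = Rq A M x + dRq A M x (y - x) + d2Rq A M z (y - x) / 2"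
    using W_Taylor[OF assms] .
  then show ?thesis using hessian_bounds(2)[OF _ W_difference[OF assms], of z] by simp
qed

text \<open>Leaving \<open>W\<close> inside the hyperplane means crossing the level
  \<open>\<rho>\<close>, by continuity. The lower limit \<open>s\<close> allows the crossing to be
  sought strictly after the start, which matters when the start lies on that level.\<close>

lemma exit_point:
  assumes x: "M_inner M q x = 1" and d: "M_inner M q d = 0"
    and s: "s \<le> 1" "Rq A M (x + s *\<^sub>R d) \<le> \<rho>" and out: "x + d \<notin> W"
  obtains t where "s \<le> t" "t \<le> 1" "x + t *\<^sub>R d \<in> W" "Rq A M (x + t *\<^sub>R d) = \<rho>"
proof -
  have H: "M_inner M q (x + t *\<^sub>R d) = 1" for t
    using x d by (simp add: M_inner_simps)
  have "isCont (\<lambda>t. Rq A M (x + t *\<^sub>R d)) t" for t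
    using has_derivative_Rq_line[OF Asym M chart_nonzero[OF H]] by (rule DERIV_isCont)
  then have cont: "continuous_on {s..1} (\<lambda>t. Rq A M (x + t *\<^sub>R d))"
    by (simp add: continuous_at_imp_continuous_on)
  have "\<rho> \<le> Rq A M (x + 1 *\<^sub>R d)"
    using out H[of 1] by (simp add: W_def)
  then obtain t where "s \<le> t" "t \<le> 1" "Rq A M (x + t *\<^sub>R d) = \<rho>"
    using IVT'[of "\<lambda>t. Rq A M (x + t *\<^sub>R d)" s \<rho> 1, OF s(2) _ s(1) cont] by blast
  with H that show ?thesis by (simp add: W_def)
qed

definition opt :: "real^'n" where "opt = (1 / M_inner M q (u 1)) *\<^sub>R u 1"

lemma Rq_opt: "Rq A M opt = lam 1"
  using q_u1 Rq_scaleR[of "1 / M_inner M q (u 1)" A M "u 1"] Rq_u1 by (simp add: opt_def)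

lemma opt_in_W: "opt \<in> W"
  using q_u1 delta_nonneg Rq_opt by (simp add: W_def) (simp add: opt_def M_inner_simps \<delta>_def)

lemma dRq_opt: "dRq A M opt v = 0"
  using A_u[of 1 v] card_ge_2 by (simp add: dRq_def Rq_opt) (simp add: opt_def M_inner_simps)

text \<open>At a crossing of the level \<open>\<rho>\<close>, smoothness around the critical point
  \<open>opt\<close> gives \<open>2 * \<delta> \<le> L * N\<close>, while the radius gives
  \<open>L * N \<le> \<delta>\<close>. So \<open>N\<close> vanishes and the point is
  \<open>opt\<close> itself; this covers \<open>\<delta> = 0\<close> too.\<close>

lemma ball_subset_W:
  assumes x: "M_inner M q x = 1" and r: "L * M_inner T (x - opt) (x - opt) \<le> \<delta>"
  shows "x \<in> W"
proof (rule ccontr)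
  assume out: "x \<notin> W"
  define d where "d = x - opt"
  define N where "N = M_inner T d d"
  have N: "0 \<le> N" using spd_M_inner_nonneg[OF T] by (simp add: N_def)
  have opt1: "M_inner M q opt = 1" using opt_in_W by (simp add: W_def)
  have d: "M_inner M q d = 0" using x opt1 by (simp add: d_def M_inner_simps)
  have "Rq A M (opt + 0 *\<^sub>R d) \<le> \<rho>" using opt_in_W by (simp add: W_def)
  moreover have "opt + d \<notin> W" using out by (simp add: d_def)
  ultimately obtain t where t: "0 \<le> t" "t \<le> 1" "opt + t *\<^sub>R d \<in> W" "Rq A M (opt + t *\<^sub>R d) = \<rho>"
    using exit_point[OF opt1 d, of 0] by auto
  have "\<rho> \<le> lam 1 + L / 2 * (t\<^sup>2 * N)"
    using W_smooth[OF opt_in_W t(3)] t(4) by (simp add: Rq_opt dRq_opt M_inner_simps N_def power2_eq_square)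
  also have "t\<^sup>2 * N \<le> 1 * N"
    using t N by (intro mult_right_mono power_le_one) auto
  then have "L / 2 * (t\<^sup>2 * N) \<le> L / 2 * N"
    using L_pos by simp
  finally have "2 * \<delta> \<le> L * N" by (simp add: \<delta>_def)
  then have "L * N \<le> 0" using r delta_nonneg by (simp add: N_def d_def)
  then have "N = 0" using N L_pos by (simp add: mult_le_0_iff)
  then have "d = 0" using spd_M_inner_eq_0[OF T] by (simp add: N_def)
  then show False using out opt_in_W by (simp add: d_def)
qed

text \<open>The descent inequality holds only between points of \<open>W\<close>, so the endpoint
  must first be shown to lie there. Otherwise the path meets the level \<open>\<rho>\<close> at some
  positive \<open>t\<close> up to 1, where the same inequality gives a value below
  \<open>\<rho>\<close>.\<close>

lemma gradient_step:
  assumes x: "x \<in> W" and g: "M_inner M q g = 0"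
    and grad: "\<And>v. M_inner M q v = 0 \<Longrightarrow> dRq A M x v = M_inner T g v"
  shows "Rq A M (x - (1 / L) *\<^sub>R g) \<le> Rq A M x - M_inner T g g / (2 * L)"
proof -
  define d where "d = (- 1 / L) *\<^sub>R g"
  define N where "N = M_inner T g g"
  have x1: "M_inner M q x = 1" and x2: "Rq A M x \<le> \<rho>" using x by (auto simp: W_def)
  have d: "M_inner M q d = 0" using g by (simp add: d_def M_inner_simps M_inner_minus)
  have slope: "dRq A M x (t *\<^sub>R d) = - t * N / L" for t
    using grad[of "t *\<^sub>R d"] d by (simp add: M_inner_simps M_inner_minus d_def N_def)
  have step: "Rq A M (x + t *\<^sub>R d) \<le> Rq A M x - (t - t\<^sup>2 / 2) * N / L" if "x + t *\<^sub>R d \<in> W" for t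
  proof -
    have "M_inner T (t *\<^sub>R d) (t *\<^sub>R d) = t\<^sup>2 * N / L\<^sup>2"
      by (simp add: M_inner_simps M_inner_minus d_def N_def power2_eq_square)
    then have "Rq A M (x + t *\<^sub>R d) \<le> Rq A M x - t * N / L + L / 2 * (t\<^sup>2 * N / L\<^sup>2)"
      using W_smooth[OF x that] slope[of t] by simp
    also have "L / 2 * (t\<^sup>2 * N / L\<^sup>2) = t\<^sup>2 / 2 * N / L"
      using L_pos by (simp add: power2_eq_square)
    finally show ?thesis by (simp add: left_diff_distrib diff_divide_distrib)
  qed
  have "x + d \<in> W"
  proof (rule ccontr)
    assume out: "x + d \<notin> W"
    have "g \<noteq> 0" using out x by (auto simp: d_def)
    then have N: "0 < N / L" using spd_M_inner_pos[OF T] L_pos by (simp add: N_def)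
    \<comment> \<open>The start may itself have value \<open>\<rho>\<close>; the negative slope
      supplies a positive \<open>s\<close> from which to look for the crossing.\<close>
    have "((\<lambda>t. Rq A M (x + t *\<^sub>R d)) has_real_derivative - N / L) (at 0)"
      using has_derivative_Rq_line[OF Asym M, of x 0 d] slope[of 1] W_nonzero[OF x] by simp
    then obtain e where e: "0 < e" "\<And>h. 0 < h \<Longrightarrow> h < e \<Longrightarrow> Rq A M (x + h *\<^sub>R d) < Rq A M x"
      using DERIV_neg_dec_right[of "\<lambda>t. Rq A M (x + t *\<^sub>R d)" "- N / L" 0] N by auto
    define s where "s = min (e / 2) 1"
    have s: "0 < s" "s \<le> 1" "s < e" using e(1) by (auto simp: s_def)
    have "Rq A M (x + s *\<^sub>R d) \<le> \<rho>" using e(2)[OF s(1,3)] x2 by linarith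
    then obtain t where t: "s \<le> t" "t \<le> 1" "x + t *\<^sub>R d \<in> W" "Rq A M (x + t *\<^sub>R d) = \<rho>"
      using exit_point[OF x1 d s(2) _ out] by blast
    have "t * t \<le> t * 1" using t s by (intro mult_left_mono) auto
    then have "0 < t - t\<^sup>2 / 2" using t s unfolding power2_eq_square by linarith
    then have "0 < (t - t\<^sup>2 / 2) * (N / L)" using N by (rule mult_pos_pos)
    then show False using step[OF t(3)] t(4) x2 by simp
  qed
  then show ?thesis
    using step[of 1] by (simp add: d_def N_def)
qed

section \<open>The energy estimate for one accelerated step\<close>

definition energy :: "real^'n \<Rightarrow> real^'n \<Rightarrow> real" where
  "energy x z = Rq A M x - lam 1 + \<mu> / 2 * M_inner T (z - opt) (z - opt)"

text \<open>Strong convexity at the critical point \<open>opt\<close> bounds the distance term by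
  the gap. This is the source of the factor 2 in the convergence rate.\<close>

lemma energy_self_le:
  assumes "x \<in> W"
  shows "energy x x \<le> 2 * (Rq A M x - lam 1)"
  using W_strongly_convex[OF opt_in_W assms] by (simp add: energy_def Rq_opt dRq_opt)

lemma midpoint_in_W:
  assumes "w \<in> W" "v \<in> W" "0 < \<tau>"
  shows "(1 / (1 + \<tau>)) *\<^sub>R (w + \<tau> *\<^sub>R v) \<in> W"
proof -
  have "w + (\<tau> / (1 + \<tau>)) *\<^sub>R (v - w) \<in> W"
    using assms by (intro W_convex) auto
  moreover have "w + (\<tau> / (1 + \<tau>)) *\<^sub>R (v - w) = (1 / (1 + \<tau>)) *\<^sub>R (w + \<tau> *\<^sub>R v)"
  proof -
    have "1 - \<tau> / (1 + \<tau>) = 1 / (1 + \<tau>)" using assms(3) by (simp add: field_simps)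
    moreover have "w + c *\<^sub>R (v - w) = (1 - c) *\<^sub>R w + c *\<^sub>R v" for c
      by (simp add: algebra_simps)
    ultimately show ?thesis by (simp add: scaleR_add_right)
  qed
  ultimately show ?thesis by simp
qed

text \<open>Strong convexity at \<open>y\<close> towards \<open>w\<close> and towards
  \<open>opt\<close>, weighted by \<open>1 - \<tau>\<close> and \<open>\<tau>\<close>, is combined
  with the descent of the gradient step. The condition \<open>\<tau>\<^sup>2 * L \<le> \<mu>\<close>
  lets that descent absorb the squared gradient from the new \<open>z\<close>.\<close>

lemma energy_decrease:
  fixes w v w' :: "real^'n" and \<tau> :: real
  defines "y \<equiv> (1 / (1 + \<tau>)) *\<^sub>R (w + \<tau> *\<^sub>R v)"
  assumes w: "w \<in> W" and v: "v \<in> W" and \<tau>: "0 < \<tau>" "\<tau> \<le> 1" "\<tau>\<^sup>2 * L \<le> \<mu>"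
    and g: "M_inner M q g = 0"
    and grad: "\<And>v. M_inner M q v = 0 \<Longrightarrow> dRq A M y v = M_inner T g v"
    and w': "Rq A M w' \<le> Rq A M (y - (1 / L) *\<^sub>R g)"
  shows "energy w' ((1 - \<tau>) *\<^sub>R v + \<tau> *\<^sub>R y - (\<tau> / \<mu>) *\<^sub>R g) \<le> (1 - \<tau>) * energy w v"
proof -
  have y: "y \<in> W" unfolding y_def by (rule midpoint_in_W[OF w v \<tau>(1)])
  define p r where "p = v - opt" and "r = y - opt"
  have "(1 + \<tau>) *\<^sub>R y = w + \<tau> *\<^sub>R v" using \<tau> by (simp add: y_def)
  \<comment> \<open>The extrapolation weights make \<open>w - y\<close> a multiple of
    \<open>y - v\<close>, so the products of \<open>g\<close> with \<open>p\<close> cancel in the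
    final sum.\<close>
  then have wy: "w - y = \<tau> *\<^sub>R (r - p)"
    by (simp add: p_def r_def algebra_simps)
  have Tc: "M_inner T a b = M_inner T b a" for a b by (rule spd_M_inner_commute[OF T])
  define gp gr gg pp pr rr where "gp = M_inner T g p" and "gr = M_inner T g r"
    and "gg = M_inner T g g" and "pp = M_inner T p p" and "pr = M_inner T p r" and "rr = M_inner T r r"
  have "Rq A M y + dRq A M y (w - y) + \<mu> / 2 * M_inner T (w - y) (w - y) \<le> Rq A M w"
    by (rule W_strongly_convex[OF y w])
  moreover have "0 \<le> \<mu> / 2 * M_inner T (w - y) (w - y)"
    using mu_pos spd_M_inner_nonneg[OF T] by simp
  moreover have "dRq A M y (w - y) = \<tau> * (gr - gp)"
    using grad[OF W_difference[OF y w]] by (simp add: wy M_inner_simps gr_def gp_def)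
  ultimately have 1: "Rq A M y + \<tau> * (gr - gp) \<le> Rq A M w" by linarith
  have "opt - y = - 1 *\<^sub>R r" by (simp add: r_def)
  then have 2: "Rq A M y - gr + \<mu> / 2 * rr \<le> lam 1"
    using W_strongly_convex[OF y opt_in_W] grad[OF W_difference[OF y opt_in_W]]
    by (simp only: M_inner_simps Rq_opt gr_def rr_def)
  have gg: "0 \<le> gg" using spd_M_inner_nonneg[OF T] by (simp add: gg_def)
  have "\<tau>\<^sup>2 / (2 * \<mu>) \<le> 1 / (2 * L)"
    using \<tau>(3) mu_pos L_pos by (simp add: field_simps)
  then have "\<tau>\<^sup>2 / (2 * \<mu>) * gg \<le> gg / (2 * L)"
    using mult_right_mono[of "\<tau>\<^sup>2 / (2 * \<mu>)" "1 / (2 * L)" gg] gg by simp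
  then have 3: "Rq A M w' \<le> Rq A M y - \<tau>\<^sup>2 / (2 * \<mu>) * gg"
    using gradient_step[OF y g grad] w' by (simp add: gg_def)
  have z': "(1 - \<tau>) *\<^sub>R v + \<tau> *\<^sub>R y - (\<tau> / \<mu>) *\<^sub>R g - opt = (1 - \<tau>) *\<^sub>R p + \<tau> *\<^sub>R r - (\<tau> / \<mu>) *\<^sub>R g"
    by (simp add: p_def r_def algebra_simps)
  have "energy w' ((1 - \<tau>) *\<^sub>R v + \<tau> *\<^sub>R y - (\<tau> / \<mu>) *\<^sub>R g) = Rq A M w' - lam 1 +
    \<mu> / 2 * ((1 - \<tau>)\<^sup>2 * pp + 2 * \<tau> * (1 - \<tau>) * pr + \<tau>\<^sup>2 * rr
      - 2 * (\<tau> / \<mu>) * ((1 - \<tau>) * gp + \<tau> * gr) + (\<tau> / \<mu>)\<^sup>2 * gg)"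
    unfolding energy_def z'
    by (simp add: M_inner_simps gp_def gr_def gg_def pp_def pr_def rr_def
        Tc[of p g] Tc[of r g] Tc[of r p] power2_eq_square algebra_simps)
  also have "\<dots> = Rq A M w' - lam 1 +
      \<mu> / 2 * ((1 - \<tau>)\<^sup>2 * pp + 2 * \<tau> * (1 - \<tau>) * pr + \<tau>\<^sup>2 * rr)
      - \<tau> * ((1 - \<tau>) * gp + \<tau> * gr) + \<tau>\<^sup>2 / (2 * \<mu>) * gg"
    using mu_pos by (simp add: power2_eq_square field_simps)
  \<comment> \<open>The exact convexity identity for the squared \<open>T\<close>-norm; its last
    term is nonpositive and is dropped next.\<close>
  also have "(1 - \<tau>)\<^sup>2 * pp + 2 * \<tau> * (1 - \<tau>) * pr + \<tau>\<^sup>2 * rr =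
      (1 - \<tau>) * pp + \<tau> * rr - \<tau> * (1 - \<tau>) * M_inner T (p - r) (p - r)"
    by (simp add: M_inner_simps pp_def pr_def rr_def Tc[of r p] power2_eq_square algebra_simps)
  also have "Rq A M w' - lam 1 +
      \<mu> / 2 * ((1 - \<tau>) * pp + \<tau> * rr - \<tau> * (1 - \<tau>) * M_inner T (p - r) (p - r))
      - \<tau> * ((1 - \<tau>) * gp + \<tau> * gr) + \<tau>\<^sup>2 / (2 * \<mu>) * gg
    \<le> (Rq A M y - \<tau>\<^sup>2 / (2 * \<mu>) * gg) - lam 1 + \<mu> / 2 * ((1 - \<tau>) * pp + \<tau> * rr)
      - \<tau> * ((1 - \<tau>) * gp + \<tau> * gr) + \<tau>\<^sup>2 / (2 * \<mu>) * gg"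
    using 3 \<tau> mu_pos spd_M_inner_nonneg[OF T, of "p - r"]
    by (intro add_right_mono diff_right_mono add_mono mult_left_mono) auto
  \<comment> \<open>Regrouped so that the first bracket is bounded by fact \<open>1\<close> and the
    second is nonpositive by fact \<open>2\<close>.\<close>
  also have "\<dots> = (1 - \<tau>) * (Rq A M y + \<tau> * (gr - gp) - lam 1 + \<mu> / 2 * pp)
      + \<tau> * (Rq A M y - gr + \<mu> / 2 * rr - lam 1)"
    by (simp add: field_simps)
  also have "\<dots> \<le> (1 - \<tau>) * (Rq A M w - lam 1 + \<mu> / 2 * pp) + \<tau> * 0"
    using 1 2 \<tau> by (intro add_mono[OF mult_left_mono mult_left_mono]) auto
  also have "\<dots> = (1 - \<tau>) * energy w v"
    by (simp add: energy_def pp_def p_def)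
  finally show ?thesis .
qed

section \<open>EPIC steps read in the chart\<close>

definition chart :: "real^'n \<Rightarrow> real^'n" where
  "chart x = (1 / M_inner M q x) *\<^sub>R x"

lemma chart_1: "M_inner M q x \<noteq> 0 \<Longrightarrow> M_inner M q (chart x) = 1"
  by (simp add: chart_def M_inner_simps)

lemma Rq_chart: "M_inner M q x \<noteq> 0 \<Longrightarrow> Rq A M (chart x) = Rq A M x"
  by (simp add: chart_def Rq_scaleR)

lemma chart_in_W: "x \<in> sublevel_X A M q \<Longrightarrow> chart x \<in> W"
  using chart_1[of x] Rq_chart[of x] by (simp add: W_def sublevel_X_def flip: rho)

lemma normalize_in_X:
  assumes "y \<in> W"
  shows "(1 / M_norm M y) *\<^sub>R y \<in> sublevel_X A M q"
    "Rq A M ((1 / M_norm M y) *\<^sub>R y) = Rq A M y"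
proof -
  have pos: "0 < M_inner M y y" by (rule spd_M_inner_pos[OF M W_nonzero[OF assms]])
  then show "Rq A M ((1 / M_norm M y) *\<^sub>R y) = Rq A M y"
    by (intro Rq_scaleR) (simp add: M_norm_def)
  then show "(1 / M_norm M y) *\<^sub>R y \<in> sublevel_X A M q"
    using pos assms by (auto simp: sublevel_X_def W_def M_norm_eq_1 M_inner_simps M_norm_def rho[symmetric])
qed

text \<open>The residual is evaluated at the normalized point and the derivative at its chart image.
  As \<open>c\<^sup>2\<close> is the reciprocal of the squared norm of \<open>y\<close>, one factor
  \<open>c\<close> enters the residual and one is left over.\<close>

lemma dRq_residual:
  assumes "c \<noteq> 0" "M_norm M (c *\<^sub>R y) = 1"
  shows "dRq A M y v = c * (v \<bullet> residual A M (c *\<^sub>R y))"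
proof -
  have "c\<^sup>2 * M_inner M y y = 1"
    using assms(2) unfolding M_norm_eq_1 by (simp add: M_inner_simps power2_eq_square)
  then have D: "1 / M_inner M y y = c\<^sup>2" by (auto simp: divide_eq_eq)
  have "dRq A M y v = (1 / M_inner M y y) * (2 * (M_inner A v y - Rq A M y * M_inner M v y))"
    by (simp add: dRq_def)
  also have "\<dots> = c * (v \<bullet> residual A M (c *\<^sub>R y))"
    unfolding D using assms(1)
    by (simp add: residual_def Rq_scaleR M_inner_def inner_diff_right matrix_vector_mult_scaleR
        power2_eq_square algebra_simps)
  finally show ?thesis .
qed

lemma epic_step_energy:
  assumes x: "x \<in> sublevel_X A M q" and z: "M_inner M q z > 0" "chart z \<in> W"
    and \<tau>: "0 < \<tau>" "\<tau> \<le> 1" "\<tau>\<^sup>2 * L \<le> \<mu>"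
    and step: "epic_step A M T q \<tau> \<mu> x z x' z'"
  shows "x' \<in> sublevel_X A M q" "Rq A M x' \<le> Rq A M x" "M_inner M q z' > 0"
    "energy (chart x') (chart z') \<le> (1 - \<tau>) * energy (chart x) (chart z)"
proof -
  obtain xb rt \<eta>1 \<eta>2 where \<eta>: "\<eta>1 > 0" "\<eta>2 > 0"
    and xb: "xb = (1 / \<eta>1) *\<^sub>R ((1 / M_inner M q x) *\<^sub>R x + (\<tau> / M_inner M q z) *\<^sub>R z)"
      "M_norm M xb = 1"
    and rt: "rt = prec_residual A M T q xb"
    and z': "z' = (1 / \<eta>2) *\<^sub>R (((1 - \<tau>) / M_inner M q z) *\<^sub>R z + (\<tau> / M_inner M q xb) *\<^sub>R xb
                            - (\<tau> * M_inner M q xb / \<mu>) *\<^sub>R rt)"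
    and x': "is_arg_min (Rq A M) (\<lambda>y. y \<in> sublevel_X A M q \<inter> span {q, x, xb, rt}) x'"
    using step unfolding epic_step_def by blast
  have x'X: "x' \<in> sublevel_X A M q"
    and min: "\<And>y. y \<in> sublevel_X A M q \<Longrightarrow> y \<in> span {q, x, xb, rt} \<Longrightarrow> Rq A M x' \<le> Rq A M y"
    using x' by (auto simp: is_arg_min_def not_less)
  show "x' \<in> sublevel_X A M q" by (rule x'X)
  show "Rq A M x' \<le> Rq A M x" using min[OF x] by (simp add: span_base)
  define y where "y = (1 / (1 + \<tau>)) *\<^sub>R (chart x + \<tau> *\<^sub>R chart z)"
  have W: "chart x \<in> W" "y \<in> W"
    using chart_in_W[OF x] midpoint_in_W[OF chart_in_W[OF x] z(2) \<tau>(1)] by (auto simp: y_def)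
  define c where "c = (1 + \<tau>) / \<eta>1"
  have c: "0 < c" using \<eta> \<tau> by (simp add: c_def)
  have xby: "xb = c *\<^sub>R y"
    using \<tau> by (simp add: xb(1) c_def y_def chart_def)
  have qy: "M_inner M q y = 1" using W by (simp add: W_def)
  have qxb: "M_inner M q xb = c" by (simp add: xby M_inner_simps qy)
  \<comment> \<open>The \<open>T\<close>-gradient at \<open>y\<close>. Its factor \<open>c\<close>
    is the coefficient \<open>M_inner M q xb\<close> in the update of \<open>z\<close>.\<close>
  define g where "g = c *\<^sub>R rt"
  have qg: "M_inner M q g = 0"
    using prec_residual_properties(1)[OF M T q_nonzero] by (simp add: g_def rt M_inner_simps)
  have grad: "dRq A M y v = M_inner T g v" if "M_inner M q v = 0" for v
    using dRq_residual[of c y v] c xb(2) prec_residual_properties(2)[OF M T q_nonzero that, of A xb]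
    by (simp add: g_def rt M_inner_simps flip: xby)
  have z'_eq: "z' = (1 / \<eta>2) *\<^sub>R ((1 - \<tau>) *\<^sub>R chart z + \<tau> *\<^sub>R y - (\<tau> / \<mu>) *\<^sub>R g)"
    unfolding z' qxb using c by (simp add: chart_def g_def xby)
  have "M_inner M q ((1 - \<tau>) *\<^sub>R chart z + \<tau> *\<^sub>R y - (\<tau> / \<mu>) *\<^sub>R g) = 1"
    using z(1) by (simp add: M_inner_simps qg qy chart_1)
  then have qz': "M_inner M q z' = 1 / \<eta>2" unfolding z'_eq M_inner_simps(6) by simp
  then show "M_inner M q z' > 0" using \<eta> by simp
  have chart_z': "chart z' = (1 - \<tau>) *\<^sub>R chart z + \<tau> *\<^sub>R y - (\<tau> / \<mu>) *\<^sub>R g"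
    unfolding chart_def[of z'] qz' using \<eta> by (simp add: z'_eq)
  define s where "s = y - (1 / L) *\<^sub>R g"
  have s_le: "Rq A M s \<le> Rq A M y - M_inner T g g / (2 * L)"
    unfolding s_def by (rule gradient_step[OF W(2) qg grad])
  have "0 \<le> M_inner T g g / (2 * L)"
    using spd_M_inner_nonneg[OF T] L_pos by simp
  then have "Rq A M s \<le> \<rho>" using s_le W(2) by (simp add: W_def)
  moreover have "M_inner M q s = 1" by (simp add: s_def M_inner_simps qy qg)
  ultimately have sW: "s \<in> W" by (simp add: W_def)
  \<comment> \<open>The gradient step stays in the searched subspace, so after normalization it
    competes in the arg min.\<close>
  have "s = (1 / c) *\<^sub>R xb - (c / L) *\<^sub>R rt" using c by (simp add: s_def g_def xby)
  then have "s \<in> span {q, x, xb, rt}"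
    by (simp only:) (intro span_diff span_scale span_base; simp)
  then have "Rq A M x' \<le> Rq A M s"
    using min[OF normalize_in_X(1)[OF sW]] normalize_in_X(2)[OF sW] by (simp add: span_scale)
  moreover have "Rq A M (chart x') = Rq A M x'"
    using x'X by (intro Rq_chart) (simp add: sublevel_X_def)
  ultimately have "Rq A M (chart x') \<le> Rq A M (y - (1 / L) *\<^sub>R g)" by (simp add: s_def)
  then show "energy (chart x') (chart z') \<le> (1 - \<tau>) * energy (chart x) (chart z)"
    unfolding chart_z' y_def
    by (intro energy_decrease W z \<tau> qg grad) (auto simp: y_def[symmetric] grad)
qed

text \<open>The one-step estimate requires the chart image of \<open>z k\<close> to lie in
  \<open>W\<close>, so the induction carries this along with the decay: the energy bounds the
  distance to \<open>opt\<close>, and \<open>ball_subset_W\<close> applies again.\<close>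

lemma epic_convergence:
  fixes x z :: "nat \<Rightarrow> real^'n"
  assumes \<tau>: "0 < \<tau>" "\<tau> \<le> 1" "\<tau>\<^sup>2 * L \<le> \<mu>"
    and x0: "x 0 \<in> sublevel_X A M q" "4 * L * (Rq A M (x 0) - lam 1) \<le> \<mu> * \<delta>"
    and z0: "z 0 = x 0"
    and iter: "epic_iteration A M T q \<tau> \<mu> x z"
  shows "Rq A M (x (Suc k)) \<le> Rq A M (x k)"
    "Rq A M (x k) - lam 1 \<le> 2 * (1 - \<tau>) ^ k * (Rq A M (x 0) - lam 1)"
proof -
  define E where "E k = energy (chart (x k)) (chart (z k))" for k
  define \<epsilon> where "\<epsilon> = Rq A M (x 0) - lam 1"
  have qpos: "M_inner M q y > 0" if "y \<in> sublevel_X A M q" for y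
    using that by (simp add: sublevel_X_def)
  have Rqc: "Rq A M (chart y) = Rq A M y" if "y \<in> sublevel_X A M q" for y
    using qpos[OF that] by (simp add: Rq_chart)
  have ge: "lam 1 \<le> Rq A M y" if "y \<in> sublevel_X A M q" for y
    using Rq_ge_lam1[OF W_nonzero[OF chart_in_W[OF that]]] Rqc[OF that] by simp
  have E0: "E 0 \<le> 2 * \<epsilon>"
    using energy_self_le[OF chart_in_W[OF x0(1)]] Rqc[OF x0(1)] by (simp add: E_def z0 \<epsilon>_def)
  have inv: "x k \<in> sublevel_X A M q \<and> M_inner M q (z k) > 0 \<and> chart (z k) \<in> W \<and>
      E k \<le> (1 - \<tau>) ^ k * (2 * \<epsilon>)" for k
  proof (induction k)
    case 0
    then show ?case using x0(1) qpos chart_in_W E0 by (simp add: z0)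
  next
    case (Suc k)
    have step: "epic_step A M T q \<tau> \<mu> (x k) (z k) (x (Suc k)) (z (Suc k))"
      using iter by (simp add: epic_iteration_def)
    note S = epic_step_energy[OF _ _ _ \<tau> step]
    have X: "x (Suc k) \<in> sublevel_X A M q" and Z: "M_inner M q (z (Suc k)) > 0"
      and "E (Suc k) \<le> (1 - \<tau>) * E k"
      using S Suc by (auto simp: E_def)
    moreover have "(1 - \<tau>) * E k \<le> (1 - \<tau>) * ((1 - \<tau>) ^ k * (2 * \<epsilon>))"
      using Suc \<tau> by (intro mult_left_mono) auto
    ultimately have E: "E (Suc k) \<le> (1 - \<tau>) ^ Suc k * (2 * \<epsilon>)" by simp
    have "0 \<le> \<epsilon>" using ge[OF x0(1)] by (simp add: \<epsilon>_def)
    then have "(1 - \<tau>) ^ Suc k * (2 * \<epsilon>) \<le> 1 * (2 * \<epsilon>)"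
      using \<tau> by (intro mult_right_mono power_le_one) auto
    then have E2: "E (Suc k) \<le> 2 * \<epsilon>" using E by linarith
    define N where "N = M_inner T (chart (z (Suc k)) - opt) (chart (z (Suc k)) - opt)"
    have "\<mu> / 2 * N \<le> E (Suc k)"
      using ge[OF X] Rqc[OF X] by (simp add: E_def energy_def N_def)
    then have "\<mu> * N \<le> 4 * \<epsilon>" using E2 by simp
    \<comment> \<open>The 4 in the initial condition is a 2 from the initial energy times a 2 from
      the factor \<open>\<mu> / 2\<close> in the energy.\<close>
    then have "L * (\<mu> * N) \<le> L * (4 * \<epsilon>)" using L_pos by (intro mult_left_mono) auto
    then have "\<mu> * (L * N) \<le> \<mu> * \<delta>" using x0(2) by (simp add: \<epsilon>_def algebra_simps)
    then have "L * N \<le> \<delta>" using mu_pos by simp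
    then have "chart (z (Suc k)) \<in> W"
      using chart_1[of "z (Suc k)"] Z by (intro ball_subset_W) (auto simp: N_def)
    then show ?case using X Z E by blast
  qed
  have step: "epic_step A M T q \<tau> \<mu> (x k) (z k) (x (Suc k)) (z (Suc k))"
    using iter by (simp add: epic_iteration_def)
  show "Rq A M (x (Suc k)) \<le> Rq A M (x k)"
    using epic_step_energy(2)[OF _ _ _ \<tau> step] inv by blast
  have "Rq A M (x k) - lam 1 \<le> E k"
    using mu_pos spd_M_inner_nonneg[OF T] Rqc inv[of k] by (simp add: E_def energy_def)
  then show "Rq A M (x k) - lam 1 \<le> 2 * (1 - \<tau>) ^ k * (Rq A M (x 0) - lam 1)"
    using inv[of k] by (simp add: \<epsilon>_def algebra_simps)
qed

end

section \<open>The hypotheses of the theorem translated to the chart\<close>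

theorem theorem5p1:
  fixes A M T :: "real^'n^'n"
    and Q :: "real^'m^'n"
    and q :: "real^'n"
    and lam :: "nat \<Rightarrow> real"
    and u x z :: "nat \<Rightarrow> real^'n"
    and P B :: "real^'m^'m"
    and \<rho> \<xi>min \<xi>max chi \<mu> L \<kappa> \<tau> :: real
  assumes dim: "CARD('n) = CARD('m) + 1"
    and spd: "spd A" "spd M" "spd T"
    and eigs: "pencil_eigensystem A M lam u" "0 < lam 1" "lam 1 < lam 2"
    and q: "M_norm M q = 1" "M_inner M q (u 1) > 0"
    and Q: "transpose (prepend_column q Q) ** M ** prepend_column q Q = mat 1"
    and P: "P = transpose Q ** T ** Q"
    and B: "B = transpose Q ** A ** Q"
    and \<xi>min: "\<xi>min = Min (pencil_eigenvalues B P)"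
    and \<xi>max: "\<xi>max = Max (pencil_eigenvalues B P)"
    and \<rho>: "\<rho> = Rq A M q"
    and chi: "chi = chi_P (lam 1) (lam 2) \<xi>min \<xi>max"
    and \<mu>: "\<mu> = mu_P (lam 1) (lam 2) \<xi>min \<xi>max \<rho>"
    and L: "L = L_P (lam 1) (lam 2) (lam CARD('n)) \<xi>min \<xi>max \<rho>"
    and \<kappa>: "\<kappa> = L / \<mu>"
    and \<rho>_bounds: "lam 1 \<le> \<rho>" "\<rho> < lam 1 + (lam 2 - lam 1) / (2 + chi)"
    and step_size: "0 < \<tau>" "\<tau> \<le> \<kappa> powr (-1/2)"
    and x0: "x 0 \<in> sublevel_X A M q"
      "0 \<le> Rq A M (x 0) - lam 1"
      "Rq A M (x 0) - lam 1 \<le> 1 / max (8 * \<kappa>) (2 * \<kappa> * (1 + \<tau> * \<kappa>)^2) * (\<rho> - lam 1)"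
    and z0: "z 0 = x 0"
    and iter: "epic_iteration A M T q \<tau> \<mu> x z"
  shows "\<forall>k\<ge>1.
      (\<forall>j\<in>{1..k}. Rq A M (x j) \<le> Rq A M (x (j - 1))) \<and>
      Rq A M (x k) - lam 1 \<le> 2 * (1 - \<tau>)^k * (Rq A M (x 0) - lam 1)"
proof -
  \<comment> \<open>The type \<open>'m\<close> is nonempty, hence index 2 is in range and
    \<open>lam 2\<close> really is an eigenvalue of the pencil.\<close>
  have n2: "2 \<le> CARD('n)"
    using dim zero_less_card_finite[where 'a = 'm] by linarith
  interpret spd_pencil A M lam u
    using spd eigs n2 by unfold_locales auto
  have qq: "M_inner M q q = 1" using q(1) by (simp add: M_norm_eq_1)
  note spdPB = spd_compression[OF dim Q spd(3), folded P] spd_compression[OF dim Q spd(1), folded B]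
  note xi = pencil_eigenvalue_bounds[OF spdPB, folded \<xi>min \<xi>max]
  interpret epic_chart A M lam u T q \<rho> \<xi>min \<xi>max chi \<mu> L
  proof unfold_locales
    fix v assume "M_inner M q v = 0"
    then obtain a where "v = Q *v a" using tangent_iff_range_Q[OF dim Q] by blast
    then show "\<xi>min * M_inner T v v \<le> M_inner A v v \<and> M_inner A v v \<le> \<xi>max * M_inner T v v"
      using xi(3,4)[of a] by (simp add: P B M_inner_congruence)
  qed (use spd q qq xi \<rho> chi \<mu> L \<rho>_bounds in auto)
  have \<kappa>1: "1 \<le> \<kappa>" using mu_pos mu_le_L by (simp add: \<kappa>)
  have "\<kappa> powr (-1/2) \<le> \<kappa> powr 0" using \<kappa>1 by (intro powr_mono) auto
  then have \<tau>1: "\<tau> \<le> 1" using step_size(2) \<kappa>1 by simp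
  have "\<tau>\<^sup>2 \<le> \<kappa> powr (-1/2) * \<kappa> powr (-1/2)"
    unfolding power2_eq_square using step_size by (intro mult_mono) auto
  also have "\<dots> = 1 / \<kappa>"
    using \<kappa>1 by (simp add: powr_minus_divide flip: powr_add)
  finally have \<tau>2: "\<tau>\<^sup>2 * L \<le> \<mu>"
    using mu_pos L_pos by (simp add: \<kappa> field_simps)
  \<comment> \<open>Comparison with the entry \<open>8 * \<kappa>\<close> bounds the initial gap by
    \<open>\<delta> / (8 * \<kappa>)\<close>, and with a nonnegative gap this gives the initial
    condition of \<open>epic_convergence\<close>.\<close>
  have "1 / max (8 * \<kappa>) (2 * \<kappa> * (1 + \<tau> * \<kappa>)\<^sup>2) \<le> 1 / (8 * \<kappa>)"
    using \<kappa>1 by (intro divide_left_mono) auto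
  then have "Rq A M (x 0) - lam 1 \<le> 1 / (8 * \<kappa>) * \<delta>"
    using x0(3) delta_nonneg unfolding \<delta>_def[symmetric] by (meson mult_right_mono order_trans)
  then have "8 * L * (Rq A M (x 0) - lam 1) \<le> \<mu> * \<delta>"
    using mu_pos L_pos by (simp add: \<kappa> field_simps)
  moreover have "0 \<le> L * (Rq A M (x 0) - lam 1)" using L_pos x0(2) by simp
  ultimately have start: "4 * L * (Rq A M (x 0) - lam 1) \<le> \<mu> * \<delta>" by linarith
  note conv = epic_convergence[OF step_size(1) \<tau>1 \<tau>2 x0(1) start z0 iter]
  show ?thesis
  proof (intro allI impI conjI ballI)
    fix k j :: nat assume "1 \<le> k"
    show "Rq A M (x k) - lam 1 \<le> 2 * (1 - \<tau>) ^ k * (Rq A M (x 0) - lam 1)" by (rule conv(2))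
    assume "j \<in> {1..k}"
    then show "Rq A M (x j) \<le> Rq A M (x (j - 1))" using conv(1)[of "j - 1"] by simp
  qed
qed

end
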